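(* Let $\mathscr{F}$ be an idempotent topologizing system on the commutative ring $R$ and let $\phi:R\rightarrow S$ be a homomorphism of commutative rings such that $IS=S$ for all $I\in\mathscr{F}$. Then the following hold. (i) For each $S$-module $M$ (viewed as an $R$-module via $\phi$), the canonical map $j_M:M\rightarrow M_{\mathscr{F}}$ is bijective. (ii) The map $\psi=j_S^{-1}\circ\phi_{\mathscr{F}}$ is the only ring homomorphism from $R_{\mathscr{F}}$ into $S$ such that $\phi=\psi\circ j_R$.
   Context: All rings are commutative. A topologizing system on a ring $R$ is a non-empty family $\mathscr{F}$ of ideals of $R$ such that every ideal containing a member of $\mathscr{F}$ belongs to $\mathscr{F}$, and $\mathscr{F}$ is stable under finite intersections. An $R$-module $M$ is $\mathscr{F}$-negligible if $\operatorname{Ann}_R(m)\in\mathscr{F}$ for every $m\in M$. For topologizing systems $\mathscr{F},\mathscr{G}$ on $R$, $\mathscr{F}.\mathscr{G}$ is the set of ideals $I$ of $R$ for which there is $J\in\mathscr{G}$ with $I\subseteq J$ and $J/I$ $\mathscr{F}$-negligible; $\mathscr{F}$ is idempotent if $\mathscr{F}.\mathscr{F}=\mathscr{F}$. For an $R$-module $M$, $\mathscr{F}(M)=\{m\in M:\operatorname{Ann}_R(m)\in\mathscr{F}\}$ (a submodule), and the Gabriel localization is $M_{\mathscr{F}}=\operatorname{colim}_{I\in\mathscr{F}}\operatorname{Hom}_R(I,M/\mathscr{F}(M))$, where $\mathscr{F}$ is directed by reverse inclusion and the transition maps are restrictions; $[f]$ denotes the class of $f:I\to M/\mathscr{F}(M)$.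 The canonical map $j_M:M\to M_{\mathscr{F}}$ sends $m$ to the class of $R\to M/\mathscr{F}(M)$, $r\mapsto rm+\mathscr{F}(M)$. For an $R$-linear map $u:M\to N$, the map $u_{\mathscr{F}}:M_{\mathscr{F}}\to N_{\mathscr{F}}$ is $[f]\mapsto[\overline{u}\circ f]$, where $\overline{u}:M/\mathscr{F}(M)\to N/\mathscr{F}(N)$ is induced by $u$. In $\phi_{\mathscr{F}}:R_{\mathscr F}\to S_{\mathscr F}$, $S$ is regarded as an $R$-module via $\phi$. $R_{\mathscr{F}}$ is a commutative ring: for $f:I\to R/\mathscr{F}(R)$ and $g:J\to R/\mathscr{F}(R)$ $R$-linear with $I,J\in\mathscr{F}$, put $\overline{J}=(J+\mathscr{F}(R))/\mathscr{F}(R)$ and $\overline{g}:\overline{J}\to R/\mathscr{F}(R)$, $b+\mathscr{F}(R)\mapsto g(b)$ for $b\in J$; then $f^{-1}(\overline{J})\in\mathscr{F}$ and $[f].[g]=[\overline{g}\circ f|_{f^{-1}(\overline{J})}]$. The unit is the class of the canonical map $R\to R/\mathscr{F}(R)$, and $j_R:R\to R_{\mathscr{F}}$ is a ring homomorphism. $IS$ denotes the ideal of $S$ generated by $\phi(I)$. *)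

theory Defs
  imports "HOL-Algebra.Module" "HOL-Algebra.QuotRing"
begin

section \<open>Modules\<close>

text \<open>
  The HOL-Algebra record of modules extends the record of rings. The fields \<open>mult\<close> and \<open>one\<close>
  play no role for a module (the locale \<^locale>\<open>module\<close> does not mention them); where a module
  is constructed that has no natural multiplication they are left \<^const>\<open>undefined\<close>.
\<close>

definition reg_mod :: "('r, 'x) ring_scheme \<Rightarrow> ('r, 'r) module" where
  "reg_mod R = \<lparr>carrier = carrier R, mult = mult R, one = \<one>\<^bsub>R\<^esub>, zero = \<zero>\<^bsub>R\<^esub>, add = add R,
     smult = mult R\<rparr>"

definition res_mod :: "('r \<Rightarrow> 's) \<Rightarrow> ('s, 'm, 'z) module_scheme \<Rightarrow> ('r, 'm) module" where
  "res_mod \<phi> M = \<lparr>carrier = carrier M, mult = mult M, one = \<one>\<^bsub>M\<^esub>, zero = \<zero>\<^bsub>M\<^esub>, add = add M,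
     smult = (\<lambda>r m. \<phi> r \<odot>\<^bsub>M\<^esub> m)\<rparr>"

text \<open>
  The operations on cosets, as for \<^const>\<open>FactRing\<close>, and all operations on equivalence classes
  below are unions over representatives: if the operation is well-defined, this is a union
  of copies of one and the same class.
\<close>

definition quot_mod :: "('r, 'm, 'z) module_scheme \<Rightarrow> 'm set \<Rightarrow> ('r, 'm set) module" where
  "quot_mod M N = \<lparr>carrier = a_rcosets\<^bsub>M\<^esub> N, mult = undefined, one = undefined,
     zero = N, add = set_add M,
     smult = (\<lambda>r X. \<Union>x\<in>X. N +>\<^bsub>M\<^esub> (r \<odot>\<^bsub>M\<^esub> x))\<rparr>"

text \<open>Linear maps are taken to be extensional, so that they are determined by their values
  on the carrier.\<close>

definition mod_Hom ::
  "('r, 'x) ring_scheme \<Rightarrow> ('r, 'm, 'y) module_scheme \<Rightarrow> ('r, 'n, 'z) module_scheme \<Rightarrow> ('m \<Rightarrow> 'n) set"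
where
  "mod_Hom R M N = {f \<in> carrier M \<rightarrow>\<^sub>E carrier N.
     (\<forall>x\<in>carrier M. \<forall>y\<in>carrier M. f (x \<oplus>\<^bsub>M\<^esub> y) = f x \<oplus>\<^bsub>N\<^esub> f y) \<and>
     (\<forall>r\<in>carrier R. \<forall>x\<in>carrier M. f (r \<odot>\<^bsub>M\<^esub> x) = r \<odot>\<^bsub>N\<^esub> f x)}"

definition annih :: "('r, 'x) ring_scheme \<Rightarrow> ('r, 'm, 'z) module_scheme \<Rightarrow> 'm \<Rightarrow> 'r set" where
  "annih R M m = {r \<in> carrier R. r \<odot>\<^bsub>M\<^esub> m = \<zero>\<^bsub>M\<^esub>}"


section \<open>Topologizing systems\<close>

definition topologizing_system :: "('r, 'x) ring_scheme \<Rightarrow> 'r set set \<Rightarrow> bool" where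
  "topologizing_system R F \<longleftrightarrow>
     F \<noteq> {} \<and> (\<forall>I\<in>F. ideal I R) \<and>
     (\<forall>I\<in>F. \<forall>J. ideal J R \<and> I \<subseteq> J \<longrightarrow> J \<in> F) \<and>
     (\<forall>I\<in>F. \<forall>J\<in>F. I \<inter> J \<in> F)"

definition negligible ::
  "('r, 'x) ring_scheme \<Rightarrow> 'r set set \<Rightarrow> ('r, 'm, 'z) module_scheme \<Rightarrow> bool" where
  "negligible R F M \<longleftrightarrow> (\<forall>m\<in>carrier M. annih R M m \<in> F)"

abbreviation ideal_mod :: "('r, 'x) ring_scheme \<Rightarrow> 'r set \<Rightarrow> ('r, 'r) module" where
  "ideal_mod R I \<equiv> (reg_mod R)\<lparr>carrier := I\<rparr>"

definition ts_prod :: "('r, 'x) ring_scheme \<Rightarrow> 'r set set \<Rightarrow> 'r set set \<Rightarrow> 'r set set" where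
  "ts_prod R F G =
     {I. ideal I R \<and> (\<exists>J\<in>G. I \<subseteq> J \<and> negligible R F (quot_mod (ideal_mod R J) I))}"

definition idempotent_ts :: "('r, 'x) ring_scheme \<Rightarrow> 'r set set \<Rightarrow> bool" where
  "idempotent_ts R F \<longleftrightarrow> topologizing_system R F \<and> ts_prod R F F = F"


section \<open>Gabriel localization of modules\<close>

definition torsion ::
  "('r, 'x) ring_scheme \<Rightarrow> 'r set set \<Rightarrow> ('r, 'm, 'z) module_scheme \<Rightarrow> 'm set" where
  "torsion R F M = {m \<in> carrier M. annih R M m \<in> F}"

abbreviation tf_quot ::
  "('r, 'x) ring_scheme \<Rightarrow> 'r set set \<Rightarrow> ('r, 'm, 'z) module_scheme \<Rightarrow> ('r, 'm set) module" where
  "tf_quot R F M \<equiv> quot_mod M (torsion R F M)"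

text \<open>
  The directed colimit is the disjoint union of the sets of linear maps \<open>I \<rightarrow> M / F(M)\<close>,
  modulo the relation of having equal restrictions to some member of \<open>F\<close>.
\<close>

definition germ_reps ::
  "('r, 'x) ring_scheme \<Rightarrow> 'r set set \<Rightarrow> ('r, 'm, 'z) module_scheme
     \<Rightarrow> ('r set \<times> ('r \<Rightarrow> 'm set)) set" where
  "germ_reps R F M = (SIGMA I:F. mod_Hom R (ideal_mod R I) (tf_quot R F M))"

definition germ_rel ::
  "('r, 'x) ring_scheme \<Rightarrow> 'r set set \<Rightarrow> ('r, 'm, 'z) module_scheme
     \<Rightarrow> ('r set \<times> ('r \<Rightarrow> 'm set)) rel" where
  "germ_rel R F M = {((I, f), (J, g)). (I, f) \<in> germ_reps R F M \<and> (J, g) \<in> germ_reps R F M \<and>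
     (\<exists>K\<in>F. K \<subseteq> I \<inter> J \<and> restrict f K = restrict g K)}"

definition germ ::
  "('r, 'x) ring_scheme \<Rightarrow> 'r set set \<Rightarrow> ('r, 'm, 'z) module_scheme \<Rightarrow> 'r set \<Rightarrow> ('r \<Rightarrow> 'm set)
     \<Rightarrow> ('r set \<times> ('r \<Rightarrow> 'm set)) set" where
  "germ R F M I f = germ_rel R F M `` {(I, restrict f I)}"

definition gabriel_mod ::
  "('r, 'x) ring_scheme \<Rightarrow> 'r set set \<Rightarrow> ('r, 'm, 'z) module_scheme
     \<Rightarrow> ('r, ('r set \<times> ('r \<Rightarrow> 'm set)) set) module" where
  "gabriel_mod R F M =
     \<lparr>carrier = germ_reps R F M // germ_rel R F M, mult = undefined, one = undefined,
      zero = germ R F M (carrier R) (\<lambda>_. \<zero>\<^bsub>tf_quot R F M\<^esub>),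
      add = (\<lambda>X Y. \<Union>(I, f)\<in>X. \<Union>(J, g)\<in>Y. germ R F M (I \<inter> J) (\<lambda>a. f a \<oplus>\<^bsub>tf_quot R F M\<^esub> g a)),
      smult = (\<lambda>r X. \<Union>(I, f)\<in>X. germ R F M I (\<lambda>a. r \<odot>\<^bsub>tf_quot R F M\<^esub> f a))\<rparr>"

definition gabriel_can ::
  "('r, 'x) ring_scheme \<Rightarrow> 'r set set \<Rightarrow> ('r, 'm, 'z) module_scheme \<Rightarrow> 'm
     \<Rightarrow> ('r set \<times> ('r \<Rightarrow> 'm set)) set" where
  "gabriel_can R F M m = germ R F M (carrier R) (\<lambda>r. torsion R F M +>\<^bsub>M\<^esub> (r \<odot>\<^bsub>M\<^esub> m))"

definition tf_map ::
  "('r, 'x) ring_scheme \<Rightarrow> 'r set set \<Rightarrow> ('r, 'n, 'z) module_scheme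
     \<Rightarrow> ('m \<Rightarrow> 'n) \<Rightarrow> 'm set \<Rightarrow> 'n set" where
  "tf_map R F N u X = (\<Union>x\<in>X. torsion R F N +>\<^bsub>N\<^esub> u x)"

text \<open>The map \<open>M\<^sub>F \<rightarrow> N\<^sub>F\<close> induced by a linear map \<open>u : M \<rightarrow> N\<close>; the source \<open>M\<close> does not enter the
  formula.\<close>

definition gabriel_map ::
  "('r, 'x) ring_scheme \<Rightarrow> 'r set set \<Rightarrow> ('r, 'n, 'z) module_scheme \<Rightarrow> ('m \<Rightarrow> 'n)
     \<Rightarrow> ('r set \<times> ('r \<Rightarrow> 'm set)) set \<Rightarrow> ('r set \<times> ('r \<Rightarrow> 'n set)) set" where
  "gabriel_map R F N u X = (\<Union>(I, f)\<in>X. germ R F N I (tf_map R F N u \<circ> f))"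


section \<open>The localized ring\<close>

definition ideal_bar :: "('r, 'x) ring_scheme \<Rightarrow> 'r set set \<Rightarrow> 'r set \<Rightarrow> 'r set set" where
  "ideal_bar R F J =
     (let N = torsion R F (reg_mod R) in (\<lambda>b. N +>\<^bsub>R\<^esub> b) ` (J <+>\<^bsub>R\<^esub> N))"

definition hom_bar ::
  "('r, 'x) ring_scheme \<Rightarrow> 'r set set \<Rightarrow> 'r set \<Rightarrow> ('r \<Rightarrow> 'r set) \<Rightarrow> 'r set \<Rightarrow> 'r set" where
  "hom_bar R F J g X =
     (THE y. \<exists>b\<in>J. X = torsion R F (reg_mod R) +>\<^bsub>R\<^esub> b \<and> y = g b)"

definition gabriel_ring ::
  "('r, 'x) ring_scheme \<Rightarrow> 'r set set \<Rightarrow> ('r set \<times> ('r \<Rightarrow> 'r set)) set ring" where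
  "gabriel_ring R F =
     \<lparr>carrier = carrier (gabriel_mod R F (reg_mod R)),
      mult = (\<lambda>X Y. \<Union>(I, f)\<in>X. \<Union>(J, g)\<in>Y.
        germ R F (reg_mod R) {a \<in> I. f a \<in> ideal_bar R F J} (hom_bar R F J g \<circ> f)),
      one = germ R F (reg_mod R) (carrier R) (\<lambda>r. torsion R F (reg_mod R) +>\<^bsub>R\<^esub> r),
      zero = \<zero>\<^bsub>gabriel_mod R F (reg_mod R)\<^esub>,
      add = add (gabriel_mod R F (reg_mod R))\<rparr>"

end

theory Submission
  imports Defs
begin

text \<open>
  The condition \<open>IS = S\<close> for every \<open>I\<close> in \<open>F\<close> acts like a partition of unity. Given
  \<open>I\<close> in \<open>F\<close> and an \<open>S\<close>-module \<open>M\<close>, consider an ideal of \<open>S\<close> that contains \<open>\<phi>(I)\<close>; it must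
  contain \<open>1\<close>. Applied to the annihilator of an element of \<open>M\<close>, this shows that an element
  killed by \<open>\<phi>(I)\<close> is zero, so \<open>M\<close> is torsion-free (\<open>zero_if_annihilated\<close>). Applied to the set of
  scalars \<open>s\<close> for which \<open>s \<cdot> g\<close> is multiplication by an element of \<open>M\<close>, where \<open>g : I \<rightarrow> M\<close> is
  linear, it shows that \<open>g\<close> itself is such a multiplication (\<open>linear_map_is_multiplication\<close>):
  for \<open>s = \<phi>(b)\<close> with \<open>b\<close> in \<open>I\<close> one has \<open>\<phi>(b) g(a) = g(ba) = \<phi>(a) g(b)\<close>. The first fact says
  that \<open>M \<rightarrow> M\<^sub>F\<close> is injective, the second that it is surjective (\<open>gabriel_can_bij\<close>).

  For the second part, let \<open>T\<close> be the torsion of \<open>R\<close>. Then \<open>\<phi>\<close> kills \<open>T\<close>, and the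
  two facts show that for a germ \<open>x = [f : I \<rightarrow> R/T]\<close> there is exactly one \<open>s\<close> in \<open>S\<close> with
  \<open>\<phi>(a) s = \<phi>(c)\<close> whenever \<open>a\<close> is in \<open>I\<close> and \<open>f(a) = T + c\<close>. Unwinding the definitions,
  \<open>\<psi>(x)\<close> is this \<open>s\<close> (\<open>factor_map_germ_eqI\<close>, \<open>factor_map_germ\<close>). That \<open>\<psi>\<close> preserves sums,
  products and the unit and extends \<open>\<phi>\<close> is then checked on these equations. It is the only
  such homomorphism because the equation \<open>j\<^sub>R(a) \<cdot> x = j\<^sub>R(c)\<close> already holds in \<open>R\<^sub>F\<close>
  (\<open>can_mult_germ\<close>), so every homomorphism extending \<open>\<phi>\<close> takes \<open>x\<close> to a solution.

  What remains is that the operations on germs do not depend on representatives. For the product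
  this is where idempotence enters: it makes \<open>R/T\<close> torsion-free, so that a linear map
  \<open>J \<rightarrow> R/T\<close> factors through the image of \<open>J\<close> in \<open>R/T\<close> (\<open>hom_bar_coset\<close>), and it puts the
  domain of the composite into \<open>F\<close> (\<open>prod_dom_mem\<close>).
\<close>

section \<open>Quotients of modules\<close>

lemma reg_mod_simps [simp]:
  "carrier (reg_mod R) = carrier R" "add (reg_mod R) = add R" "zero (reg_mod R) = zero R"
  "smult (reg_mod R) = mult R"
  by (simp_all add: reg_mod_def)

lemma res_mod_simps [simp]:
  "carrier (res_mod h M) = carrier M" "add (res_mod h M) = add M" "zero (res_mod h M) = zero M"
  "smult (res_mod h M) = (\<lambda>r. smult M (h r))"
  by (simp_all add: res_mod_def)

text \<open>Closure under negation is multiplication by \<open>-1\<close>.\<close>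
lemma (in cring) submodule_idealI:
  assumes "I \<subseteq> carrier R" "\<zero> \<in> I" "\<And>a b. a \<in> I \<Longrightarrow> b \<in> I \<Longrightarrow> a \<oplus> b \<in> I"
    "\<And>r a. r \<in> carrier R \<Longrightarrow> a \<in> I \<Longrightarrow> r \<otimes> a \<in> I"
  shows "ideal I R"
proof (rule idealI)
  have "\<ominus> a \<in> I" if "a \<in> I" for a
    using assms(4)[of "\<ominus> \<one>" a] that assms(1) by (auto simp: l_minus)
  then show "subgroup I (add_monoid R)"
    using assms by (intro add.subgroupI) auto
  show "a \<otimes> x \<in> I" if "a \<in> I" "x \<in> carrier R" for a x
    using assms(1) assms(4)[OF that(2,1)] that m_comm[of a x] by (auto simp: subset_iff)
qed (use assms ring_axioms in auto)

lemma a_r_coset_cong: "add M = add M' \<Longrightarrow> N +>\<^bsub>M\<^esub> x = N +>\<^bsub>M'\<^esub> x"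
  by (simp add: a_r_coset_def')

lemma reg_mod_coset [simp]: "N +>\<^bsub>reg_mod R\<^esub> x = N +>\<^bsub>R\<^esub> x"
  by (rule a_r_coset_cong) simp

lemma reg_mod_a_inv [simp]: "a_inv (reg_mod R) = a_inv R"
  by (simp add: a_inv_def m_inv_def fun_eq_iff)

lemma res_mod_coset [simp]: "N +>\<^bsub>res_mod h M\<^esub> x = N +>\<^bsub>M\<^esub> x"
  by (rule a_r_coset_cong) simp

lemma (in cring) reg_mod_module: "module R (reg_mod R)"
proof (rule moduleI)
  show "abelian_group (reg_mod R)"
    by (rule abelian_groupI) (auto simp: a_ac intro!: bexI[of _ "\<ominus> _"] l_neg)
qed (auto simp: l_distr r_distr m_assoc cring_axioms)

lemma res_mod_module:
  assumes "cring R" "module S M" "h \<in> ring_hom R S"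
  shows "module R (res_mod h M)"
proof -
  interpret M: module S M by fact
  note hom = ring_hom_closed[OF assms(3)] ring_hom_add[OF assms(3)] ring_hom_mult[OF assms(3)]
    ring_hom_one[OF assms(3)]
  show ?thesis
  proof (rule moduleI)
    show "abelian_group (res_mod h M)"
      by (rule abelian_groupI) (auto simp: M.M.a_ac intro!: bexI[of _ "\<ominus>\<^bsub>M\<^esub> _"] M.M.l_neg)
  qed (auto simp: hom M.smult_l_distr M.smult_r_distr M.smult_assoc1 assms(1))
qed

context module
begin

lemma annih_ideal: "m \<in> carrier M \<Longrightarrow> ideal (annih R M m) R"
  by (rule R.submodule_idealI) (auto simp: annih_def smult_l_distr smult_assoc1)

lemma submodule_abelian_subgroup: "submodule N R M \<Longrightarrow> abelian_subgroup N M"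
  by (simp add: abelian_subgroupI3 additive_subgroup.intro submodule_def M.abelian_group_axioms)

lemma quot_mod_zero [simp]: "\<zero>\<^bsub>quot_mod M N\<^esub> = N"
  by (simp add: quot_mod_def)

lemma quot_mod_carrier: "X \<in> carrier (quot_mod M N) \<longleftrightarrow> (\<exists>x\<in>carrier M. X = N +>\<^bsub>M\<^esub> x)"
  by (auto simp: quot_mod_def A_RCOSETS_def')

lemma quot_mod_coset_eq_iff:
  assumes "submodule N R M" "x \<in> carrier M" "y \<in> carrier M"
  shows "N +>\<^bsub>M\<^esub> x = N +>\<^bsub>M\<^esub> y \<longleftrightarrow> x \<oplus>\<^bsub>M\<^esub> \<ominus>\<^bsub>M\<^esub> y \<in> N"
proof -
  interpret abelian_subgroup N M using submodule_abelian_subgroup assms(1) .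
  show ?thesis using assms a_rcos_module a_repr_independence' a_repr_independenceD by metis
qed

lemma quot_mod_coset_zero_iff:
  assumes "submodule N R M" "x \<in> carrier M"
  shows "N +>\<^bsub>M\<^esub> x = N \<longleftrightarrow> x \<in> N"
  using submodule_abelian_subgroup[OF assms(1)] assms(2)
  by (metis abelian_subgroup.a_rcos_const abelian_subgroup.a_rcos_self)

lemma quot_mod_self_mem: "submodule N R M \<Longrightarrow> x \<in> carrier M \<Longrightarrow> x \<in> N +>\<^bsub>M\<^esub> x"
  by (meson abelian_subgroup.a_rcos_self submodule_abelian_subgroup)

lemma quot_mod_add:
  assumes "submodule N R M" "x \<in> carrier M" "y \<in> carrier M"
  shows "(N +>\<^bsub>M\<^esub> x) \<oplus>\<^bsub>quot_mod M N\<^esub> (N +>\<^bsub>M\<^esub> y) = N +>\<^bsub>M\<^esub> (x \<oplus>\<^bsub>M\<^esub> y)"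
  using abelian_subgroup.a_rcos_sum[OF submodule_abelian_subgroup[OF assms(1)]] assms
  by (simp add: quot_mod_def)

lemma quot_mod_smult:
  assumes N: "submodule N R M" and r: "r \<in> carrier R" and x: "x \<in> carrier M"
  shows "r \<odot>\<^bsub>quot_mod M N\<^esub> (N +>\<^bsub>M\<^esub> x) = N +>\<^bsub>M\<^esub> (r \<odot>\<^bsub>M\<^esub> x)"
proof -
  interpret abelian_subgroup N M using submodule_abelian_subgroup N .
  have "N +>\<^bsub>M\<^esub> (r \<odot>\<^bsub>M\<^esub> y) = N +>\<^bsub>M\<^esub> (r \<odot>\<^bsub>M\<^esub> x)" if y: "y \<in> N +>\<^bsub>M\<^esub> x" for y
  proof -
    have yc: "y \<in> carrier M" using a_elemrcos_carrier[OF x y] .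
    have "y \<oplus>\<^bsub>M\<^esub> \<ominus>\<^bsub>M\<^esub> x \<in> N" using a_rcos_module_imp[OF x y] .
    then have "r \<odot>\<^bsub>M\<^esub> (y \<oplus>\<^bsub>M\<^esub> \<ominus>\<^bsub>M\<^esub> x) \<in> N" using submodule.smult_closed[OF N r] by blast
    then have "r \<odot>\<^bsub>M\<^esub> y \<oplus>\<^bsub>M\<^esub> \<ominus>\<^bsub>M\<^esub> (r \<odot>\<^bsub>M\<^esub> x) \<in> N"
      using r x yc by (simp add: smult_r_distr smult_r_minus)
    then show ?thesis using quot_mod_coset_eq_iff[OF N] r x yc by simp
  qed
  moreover have "x \<in> N +>\<^bsub>M\<^esub> x" using quot_mod_self_mem N x .
  ultimately have "(\<Union>y\<in>N +>\<^bsub>M\<^esub> x. N +>\<^bsub>M\<^esub> (r \<odot>\<^bsub>M\<^esub> y)) = N +>\<^bsub>M\<^esub> (r \<odot>\<^bsub>M\<^esub> x)" by blast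
  then show ?thesis by (simp add: quot_mod_def)
qed

lemma quot_mod_module:
  assumes N: "submodule N R M"
  shows "module R (quot_mod M N)"
proof -
  interpret abelian_subgroup N M using submodule_abelian_subgroup N .
  note ops = quot_mod_add[OF N] quot_mod_smult[OF N]
  have zero: "N = N +>\<^bsub>M\<^esub> \<zero>\<^bsub>M\<^esub>" using a_subset by simp
  show ?thesis
  proof (rule moduleI)
    show "abelian_group (quot_mod M N)"
    proof (rule abelian_groupI)
      show "\<zero>\<^bsub>quot_mod M N\<^esub> \<in> carrier (quot_mod M N)"
        using zero by (auto simp: quot_mod_carrier)
      fix X assume "X \<in> carrier (quot_mod M N)"
      then obtain x where x: "x \<in> carrier M" "X = N +>\<^bsub>M\<^esub> x" by (auto simp: quot_mod_carrier)
      show "\<zero>\<^bsub>quot_mod M N\<^esub> \<oplus>\<^bsub>quot_mod M N\<^esub> X = X"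
        using ops(1)[of "\<zero>\<^bsub>M\<^esub>" x] x zero by simp
      show "\<exists>Y\<in>carrier (quot_mod M N). Y \<oplus>\<^bsub>quot_mod M N\<^esub> X = \<zero>\<^bsub>quot_mod M N\<^esub>"
        using ops(1)[of "\<ominus>\<^bsub>M\<^esub> x" x] x zero
        by (intro bexI[of _ "N +>\<^bsub>M\<^esub> (\<ominus>\<^bsub>M\<^esub> x)"]) (auto simp: quot_mod_carrier M.l_neg)
    qed (auto simp: quot_mod_carrier ops M.a_ac)
  qed (auto simp: quot_mod_carrier ops R.is_cring smult_l_distr smult_r_distr smult_assoc1)
qed

end


section \<open>Torsion and germs for a topologizing system\<close>

locale topologized_ring = cring R for R (structure) +
  fixes F
  assumes topologizing: "topologizing_system R F"
begin

lemma mem_ideal: "I \<in> F \<Longrightarrow> ideal I R"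
  and mem_upward: "I \<in> F \<Longrightarrow> ideal J R \<Longrightarrow> I \<subseteq> J \<Longrightarrow> J \<in> F"
  and mem_Int: "I \<in> F \<Longrightarrow> J \<in> F \<Longrightarrow> I \<inter> J \<in> F"
  using topologizing unfolding topologizing_system_def by blast+

lemma mem_subset: "I \<in> F \<Longrightarrow> I \<subseteq> carrier R"
  using mem_ideal additive_subgroup.a_subset ideal.axioms(1) by blast

lemma mem_closed:
  assumes "I \<in> F"
  shows "a \<in> I \<Longrightarrow> a \<in> carrier R" "a \<in> I \<Longrightarrow> b \<in> I \<Longrightarrow> a \<oplus> b \<in> I"
    "r \<in> carrier R \<Longrightarrow> a \<in> I \<Longrightarrow> r \<otimes> a \<in> I" "a \<in> I \<Longrightarrow> \<ominus> a \<in> I"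
  using mem_subset[OF assms] mem_ideal[OF assms]
  by (auto simp: ideal.I_l_closed additive_subgroup.a_closed additive_subgroup.a_inv_closed ideal.axioms(1))

lemma carrier_mem: "carrier R \<in> F"
proof -
  obtain I where "I \<in> F" using topologizing by (auto simp: topologizing_system_def)
  then show ?thesis using mem_upward[OF _ oneideal] mem_subset by blast
qed

lemma torsionI:
  assumes "module R M" "m \<in> carrier M" "I \<in> F" "\<And>a. a \<in> I \<Longrightarrow> a \<odot>\<^bsub>M\<^esub> m = \<zero>\<^bsub>M\<^esub>"
  shows "m \<in> torsion R F M"
proof -
  have "I \<subseteq> annih R M m" using assms mem_subset by (auto simp: annih_def)
  then show ?thesis
    using mem_upward[OF assms(3) module.annih_ideal[OF assms(1,2)]] assms(2) by (auto simp: torsion_def)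
qed

lemma torsionE:
  assumes "m \<in> torsion R F M"
  obtains I where "I \<in> F" "\<And>a. a \<in> I \<Longrightarrow> a \<odot>\<^bsub>M\<^esub> m = \<zero>\<^bsub>M\<^esub>" "m \<in> carrier M"
  using assms by (auto simp: torsion_def annih_def)

lemma torsion_submodule:
  assumes "module R M"
  shows "submodule (torsion R F M) R M"
proof -
  interpret M: module R M by fact
  show ?thesis
  proof (rule M.submoduleI)
    show "torsion R F M \<subseteq> carrier M" by (auto simp: torsion_def)
    show "\<zero>\<^bsub>M\<^esub> \<in> torsion R F M" by (rule torsionI[OF assms _ carrier_mem]) auto
    fix x assume "x \<in> torsion R F M"
    then obtain I where I: "I \<in> F" "\<And>a. a \<in> I \<Longrightarrow> a \<odot>\<^bsub>M\<^esub> x = \<zero>\<^bsub>M\<^esub>" "x \<in> carrier M"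
      by (auto elim: torsionE)
    show "\<ominus>\<^bsub>M\<^esub> x \<in> torsion R F M"
      using I mem_closed(1)[OF I(1)] by (intro torsionI[OF assms _ I(1)]) (auto simp: M.smult_r_minus)
    show "r \<odot>\<^bsub>M\<^esub> x \<in> torsion R F M" if "r \<in> carrier R" for r
    proof (rule torsionI[OF assms _ I(1)])
      fix a assume "a \<in> I"
      then have "a \<odot>\<^bsub>M\<^esub> (r \<odot>\<^bsub>M\<^esub> x) = r \<odot>\<^bsub>M\<^esub> (a \<odot>\<^bsub>M\<^esub> x)"
        using that I mem_closed(1)[OF I(1)] by (metis M.smult_assoc1 m_comm)
      then show "a \<odot>\<^bsub>M\<^esub> (r \<odot>\<^bsub>M\<^esub> x) = \<zero>\<^bsub>M\<^esub>" using that I \<open>a \<in> I\<close> by simp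
    qed (use that I in auto)
    fix y assume "y \<in> torsion R F M"
    then obtain J where J: "J \<in> F" "\<And>a. a \<in> J \<Longrightarrow> a \<odot>\<^bsub>M\<^esub> y = \<zero>\<^bsub>M\<^esub>" "y \<in> carrier M"
      by (auto elim: torsionE)
    show "x \<oplus>\<^bsub>M\<^esub> y \<in> torsion R F M"
      using I J mem_closed(1)[OF I(1)]
      by (intro torsionI[OF assms _ mem_Int[OF I(1) J(1)]]) (auto simp: M.smult_r_distr)
  qed
qed

lemma tf_quot_module: "module R M \<Longrightarrow> module R (tf_quot R F M)"
  by (simp add: module.quot_mod_module torsion_submodule)

text \<open>Membership with the linearity conditions written in the operations of \<open>R\<close> rather than in those
  of the ideal \<open>I\<close> regarded as a module.\<close>
lemma germ_reps_iff:
  "(I, f) \<in> germ_reps R F M \<longleftrightarrow> I \<in> F \<and> f \<in> I \<rightarrow>\<^sub>E carrier (tf_quot R F M) \<and>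
     (\<forall>x\<in>I. \<forall>y\<in>I. f (x \<oplus> y) = f x \<oplus>\<^bsub>tf_quot R F M\<^esub> f y) \<and>
     (\<forall>r\<in>carrier R. \<forall>x\<in>I. f (r \<otimes> x) = r \<odot>\<^bsub>tf_quot R F M\<^esub> f x)"
  by (auto simp: germ_reps_def mod_Hom_def)

lemma germ_reps_restrictI:
  assumes "I \<in> F" "\<And>x. x \<in> I \<Longrightarrow> f x \<in> carrier (tf_quot R F M)"
    "\<And>x y. x \<in> I \<Longrightarrow> y \<in> I \<Longrightarrow> f (x \<oplus> y) = f x \<oplus>\<^bsub>tf_quot R F M\<^esub> f y"
    "\<And>r x. r \<in> carrier R \<Longrightarrow> x \<in> I \<Longrightarrow> f (r \<otimes> x) = r \<odot>\<^bsub>tf_quot R F M\<^esub> f x"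
  shows "(I, restrict f I) \<in> germ_reps R F M"
  using assms mem_closed[OF assms(1)] by (auto simp: germ_reps_iff)

lemma germ_repsD:
  assumes "(I, f) \<in> germ_reps R F M"
  shows "I \<in> F" "x \<in> I \<Longrightarrow> f x \<in> carrier (tf_quot R F M)"
    "x \<in> I \<Longrightarrow> y \<in> I \<Longrightarrow> f (x \<oplus> y) = f x \<oplus>\<^bsub>tf_quot R F M\<^esub> f y"
    "r \<in> carrier R \<Longrightarrow> x \<in> I \<Longrightarrow> f (r \<otimes> x) = r \<odot>\<^bsub>tf_quot R F M\<^esub> f x"
    "restrict f I = f"
  using assms by (auto simp: germ_reps_iff PiE_mem extensional_restrict PiE_def)

lemma germ_reps_restrict:
  assumes "(I, f) \<in> germ_reps R F M" "K \<in> F" "K \<subseteq> I"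
  shows "(K, restrict f K) \<in> germ_reps R F M"
  using assms(2,3) by (intro germ_reps_restrictI) (simp_all add: germ_repsD[OF assms(1)] subsetD)

text \<open>Restrictions to \<open>K\<close> are equal as functions exactly if they agree pointwise on \<open>K\<close>; in this
  form the relation needs no reasoning about values outside the domain.\<close>
lemma germ_rel_iff:
  "((I, f), (J, g)) \<in> germ_rel R F M \<longleftrightarrow> (I, f) \<in> germ_reps R F M \<and> (J, g) \<in> germ_reps R F M \<and>
     (\<exists>K\<in>F. K \<subseteq> I \<and> K \<subseteq> J \<and> (\<forall>a\<in>K. f a = g a))"
proof -
  have "restrict f K = restrict g K \<longleftrightarrow> (\<forall>a\<in>K. f a = g a)" for K
    by (metis restrict_apply' restrict_ext)
  then show ?thesis by (simp add: germ_rel_def conj_assoc)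
qed

lemma germ_rel_equiv: "equiv (germ_reps R F M) (germ_rel R F M)"
proof (rule equivI)
  show "germ_rel R F M \<subseteq> germ_reps R F M \<times> germ_reps R F M" by (auto simp: germ_rel_iff)
  show "refl_on (germ_reps R F M) (germ_rel R F M)"
    using germ_repsD(1) by (fastforce simp: refl_on_def germ_rel_iff)
  show "sym (germ_rel R F M)"
  proof (rule symI, clarify)
    fix I f J g assume "((I, f), (J, g)) \<in> germ_rel R F M"
    then show "((J, g), (I, f)) \<in> germ_rel R F M" unfolding germ_rel_iff by metis
  qed
  show "trans (germ_rel R F M)"
  proof (rule transI, clarify)
    fix I f J g L h assume A: "((I, f), (J, g)) \<in> germ_rel R F M" "((J, g), (L, h)) \<in> germ_rel R F M"
    then obtain K K' where "K \<in> F" "K \<subseteq> I" "\<forall>a\<in>K. f a = g a"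
      and "K' \<in> F" "K' \<subseteq> L" "\<forall>a\<in>K'. g a = h a"
      unfolding germ_rel_iff by blast
    then have "K \<inter> K' \<in> F" "K \<inter> K' \<subseteq> I" "K \<inter> K' \<subseteq> L" "\<forall>a\<in>K \<inter> K'. f a = h a"
      by (auto intro: mem_Int)
    then show "((I, f), (L, h)) \<in> germ_rel R F M"
      using A unfolding germ_rel_iff by blast
  qed
qed

lemma germ_eqI:
  assumes "(I, restrict f I) \<in> germ_reps R F M" "(J, restrict g J) \<in> germ_reps R F M"
    and "K \<in> F" "K \<subseteq> I" "K \<subseteq> J" "\<And>a. a \<in> K \<Longrightarrow> f a = g a"
  shows "germ R F M I f = germ R F M J g"
proof -
  have "\<forall>a\<in>K. restrict f I a = restrict g J a" using assms(4-6) by (simp add: subset_iff)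
  then have "((I, restrict f I), (J, restrict g J)) \<in> germ_rel R F M"
    using assms(1-5) unfolding germ_rel_iff by blast
  then show ?thesis unfolding germ_def by (rule equiv_class_eq[OF germ_rel_equiv])
qed

lemma mem_germ_iff:
  assumes "(I, f) \<in> germ_reps R F M"
  shows "(J, g) \<in> germ R F M I f \<longleftrightarrow>
    (J, g) \<in> germ_reps R F M \<and> (\<exists>K\<in>F. K \<subseteq> I \<and> K \<subseteq> J \<and> (\<forall>a\<in>K. f a = g a))"
  using assms germ_repsD(5)[OF assms] by (simp add: germ_def germ_rel_iff)

lemma germ_self: "(I, f) \<in> germ_reps R F M \<Longrightarrow> (I, f) \<in> germ R F M I f"
  using germ_repsD(1) by (fastforce simp: mem_germ_iff)

lemma germ_eqD:
  assumes "(I, f) \<in> germ_reps R F M" "(J, g) \<in> germ_reps R F M" "germ R F M I f = germ R F M J g"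
  shows "\<exists>K\<in>F. K \<subseteq> I \<and> K \<subseteq> J \<and> (\<forall>a\<in>K. f a = g a)"
  using germ_self[OF assms(2)] assms(3) mem_germ_iff[OF assms(1), of J g] by simp

lemma gabriel_mod_carrier:
  "X \<in> carrier (gabriel_mod R F M) \<longleftrightarrow> (\<exists>I f. (I, f) \<in> germ_reps R F M \<and> X = germ R F M I f)"
proof -
  have "germ R F M I f = germ_rel R F M `` {(I, f)}" if "(I, f) \<in> germ_reps R F M" for I f
    using germ_repsD(5)[OF that] by (simp add: germ_def)
  then have "(\<exists>p\<in>germ_reps R F M. X = germ_rel R F M `` {p}) \<longleftrightarrow>
      (\<exists>I f. (I, f) \<in> germ_reps R F M \<and> X = germ R F M I f)"
    by (metis surj_pair)
  then show ?thesis by (simp add: gabriel_mod_def quotient_def)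
qed

lemma germ_in_carrier:
  assumes "(I, restrict f I) \<in> germ_reps R F M"
  shows "germ R F M I f \<in> carrier (gabriel_mod R F M)"
  using assms by (auto simp: gabriel_mod_carrier germ_def intro!: exI[of _ I] exI[of _ "restrict f I"])

text \<open>The operations on germs are unions over all representatives. If \<open>h\<close> takes the same value on all
  representatives that agree with \<open>f\<close> on a member of \<open>F\<close>, the union collapses to the
  value at \<open>f\<close>.\<close>
lemma germ_UN:
  assumes "(I, f) \<in> germ_reps R F M"
    and "\<And>I' f' K. (I', f') \<in> germ_reps R F M \<Longrightarrow> K \<in> F \<Longrightarrow> K \<subseteq> I \<Longrightarrow> K \<subseteq> I' \<Longrightarrow>
      (\<And>a. a \<in> K \<Longrightarrow> f a = f' a) \<Longrightarrow> h I' f' = h I f"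
  shows "(\<Union>(I, f)\<in>germ R F M I f. h I f) = h I f"
proof -
  have "(I, f) \<in> germ R F M I f" using germ_self[OF assms(1)] .
  moreover have "h I' f' = h I f" if "(I', f') \<in> germ R F M I f" for I' f'
    using that assms(2)[of I' f'] unfolding mem_germ_iff[OF assms(1)] by blast
  ultimately show ?thesis by blast
qed

lemma germ_UN2:
  assumes f: "(I, f) \<in> germ_reps R F M" and g: "(J, g) \<in> germ_reps R F N"
    and h: "\<And>I' f' J' g' K L. (I', f') \<in> germ_reps R F M \<Longrightarrow> (J', g') \<in> germ_reps R F N \<Longrightarrow>
      K \<in> F \<Longrightarrow> K \<subseteq> I \<Longrightarrow> K \<subseteq> I' \<Longrightarrow> (\<And>a. a \<in> K \<Longrightarrow> f a = f' a) \<Longrightarrow>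
      L \<in> F \<Longrightarrow> L \<subseteq> J \<Longrightarrow> L \<subseteq> J' \<Longrightarrow> (\<And>a. a \<in> L \<Longrightarrow> g a = g' a) \<Longrightarrow> h I' f' J' g' = h I f J g"
  shows "(\<Union>(I, f)\<in>germ R F M I f. \<Union>(J, g)\<in>germ R F N J g. h I f J g) = h I f J g"
proof -
  have J: "(\<Union>(J, g)\<in>germ R F N J g. h I' f' J g) = h I f J g"
    if "(I', f') \<in> germ_reps R F M" "K \<in> F" "K \<subseteq> I" "K \<subseteq> I'" "\<And>a. a \<in> K \<Longrightarrow> f a = f' a" for I' f' K
  proof -
    have "h I' f' J g = h I f J g"
      by (rule h[OF that(1) g that(2-5) germ_repsD(1)[OF g]]) auto
    moreover have "(\<Union>(J, g)\<in>germ R F N J g. h I' f' J g) = h I' f' J g"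
    proof (rule germ_UN[OF g])
      fix J' g' L assume "(J', g') \<in> germ_reps R F N" "L \<in> F" "L \<subseteq> J" "L \<subseteq> J'"
        "\<And>a. a \<in> L \<Longrightarrow> g a = g' a"
      then have "h I' f' J' g' = h I f J g" by (intro h[OF that(1) _ that(2-5)])
      then show "h I' f' J' g' = h I' f' J g" using \<open>h I' f' J g = h I f J g\<close> by simp
    qed
    ultimately show ?thesis by simp
  qed
  have J0: "(\<Union>(J, g)\<in>germ R F N J g. h I f J g) = h I f J g"
    using J[OF f germ_repsD(1)[OF f]] by blast
  have "(\<Union>(I, f)\<in>germ R F M I f. \<Union>(J, g)\<in>germ R F N J g. h I f J g) =
      (\<Union>(J, g)\<in>germ R F N J g. h I f J g)"
  proof (rule germ_UN[OF f])
    fix I' f' K assume "(I', f') \<in> germ_reps R F M" "K \<in> F" "K \<subseteq> I" "K \<subseteq> I'"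
      "\<And>a. a \<in> K \<Longrightarrow> f a = f' a"
    then have "(\<Union>(J, g)\<in>germ R F N J g. h I' f' J g) = h I f J g" by (rule J)
    then show "(\<Union>(J, g)\<in>germ R F N J g. h I' f' J g) = (\<Union>(J, g)\<in>germ R F N J g. h I f J g)"
      using J0 by simp
  qed
  then show ?thesis using J0 by simp
qed

lemma gabriel_add_rep:
  assumes M: "module R M" and f: "(I, f) \<in> germ_reps R F M" and g: "(J, g) \<in> germ_reps R F M"
  shows "(I \<inter> J, \<lambda>a\<in>I \<inter> J. f a \<oplus>\<^bsub>tf_quot R F M\<^esub> g a) \<in> germ_reps R F M"
proof -
  interpret Q: module R "tf_quot R F M" using tf_quot_module M .
  show ?thesis
    by (rule germ_reps_restrictI)
      (auto simp: mem_Int germ_repsD[OF f] germ_repsD[OF g] Q.M.a_ac Q.smult_r_distr)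
qed

lemma gabriel_add:
  assumes M: "module R M" and f: "(I, f) \<in> germ_reps R F M" and g: "(J, g) \<in> germ_reps R F M"
  shows "germ R F M I f \<oplus>\<^bsub>gabriel_mod R F M\<^esub> germ R F M J g =
      germ R F M (I \<inter> J) (\<lambda>a. f a \<oplus>\<^bsub>tf_quot R F M\<^esub> g a)"
proof -
  have "(\<Union>(I, f)\<in>germ R F M I f. \<Union>(J, g)\<in>germ R F M J g.
      germ R F M (I \<inter> J) (\<lambda>a. f a \<oplus>\<^bsub>tf_quot R F M\<^esub> g a)) =
      germ R F M (I \<inter> J) (\<lambda>a. f a \<oplus>\<^bsub>tf_quot R F M\<^esub> g a)"
  proof (rule germ_UN2[OF f g])
    fix I' f' J' g' K L
    assume *: "(I', f') \<in> germ_reps R F M" "(J', g') \<in> germ_reps R F M"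
      "K \<in> F" "K \<subseteq> I" "K \<subseteq> I'" "\<And>a. a \<in> K \<Longrightarrow> f a = f' a"
      "L \<in> F" "L \<subseteq> J" "L \<subseteq> J'" "\<And>a. a \<in> L \<Longrightarrow> g a = g' a"
    show "germ R F M (I' \<inter> J') (\<lambda>a. f' a \<oplus>\<^bsub>tf_quot R F M\<^esub> g' a) =
        germ R F M (I \<inter> J) (\<lambda>a. f a \<oplus>\<^bsub>tf_quot R F M\<^esub> g a)"
      by (rule germ_eqI[OF gabriel_add_rep[OF M *(1,2)] gabriel_add_rep[OF M f g]
            mem_Int[OF *(3,7)]]) (use * in auto)
  qed
  then show ?thesis by (simp add: gabriel_mod_def)
qed

lemma gabriel_can_rep:
  assumes M: "module R M" and m: "m \<in> carrier M"
  shows "(carrier R, \<lambda>r\<in>carrier R. torsion R F M +>\<^bsub>M\<^esub> (r \<odot>\<^bsub>M\<^esub> m)) \<in> germ_reps R F M"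
proof -
  interpret M: module R M by fact
  note ops = M.quot_mod_add[OF torsion_submodule[OF M]] M.quot_mod_smult[OF torsion_submodule[OF M]]
  show ?thesis
    using m by (intro germ_reps_restrictI carrier_mem)
      (auto simp: ops M.quot_mod_carrier M.smult_l_distr M.smult_assoc1)
qed

lemma germ_restrict: "germ R F M I (restrict f I) = germ R F M I f"
  by (simp add: germ_def)

lemma gabriel_can_in_carrier:
  assumes "module R M" "m \<in> carrier M"
  shows "gabriel_can R F M m \<in> carrier (gabriel_mod R F M)"
  unfolding gabriel_can_def by (rule germ_in_carrier[OF gabriel_can_rep[OF assms]])

end


section \<open>Idempotence and the product of germs\<close>

locale idempotent_system = topologized_ring +
  assumes idempotent: "ts_prod R F F = F"
begin

lemma ideal_mod_module:
  assumes "ideal J R"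
  shows "module R (ideal_mod R J)"
proof -
  interpret reg: module R "reg_mod R" by (rule reg_mod_module)
  interpret J: ideal J R by fact
  have "submodule J R (reg_mod R)"
    by (intro reg.submoduleI) (auto simp: J.I_l_closed)
  then show ?thesis by (rule submodule.submodule_is_module[OF _ reg_mod_module])
qed

text \<open>Idempotence in the form in which it is used: \<open>J/I\<close> is negligible as soon as each \<open>a\<close> in \<open>J\<close> is
  multiplied into \<open>I\<close> by some member of \<open>F\<close>, because the annihilator of the coset of \<open>a\<close> is an ideal
  that contains this member.\<close>
lemma mem_if_negligible:
  assumes J: "J \<in> F" and I: "ideal I R" "I \<subseteq> J"
    and neg: "\<And>a. a \<in> J \<Longrightarrow> \<exists>K\<in>F. \<forall>k\<in>K. k \<otimes> a \<in> I"
  shows "I \<in> F"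
proof -
  interpret J: module R "ideal_mod R J" using ideal_mod_module mem_ideal J by blast
  have sub: "submodule I R (ideal_mod R J)"
    using J.module_incl_imp_submodule[of I] ideal_mod_module[OF I(1)] I(2) by simp
  interpret Q: module R "quot_mod (ideal_mod R J) I" by (rule J.quot_mod_module[OF sub])
  have "negligible R F (quot_mod (ideal_mod R J) I)"
    unfolding negligible_def
  proof
    fix X assume X: "X \<in> carrier (quot_mod (ideal_mod R J) I)"
    then obtain a where a: "a \<in> J" "X = I +>\<^bsub>ideal_mod R J\<^esub> a"
      by (auto simp: J.quot_mod_carrier)
    obtain K where K: "K \<in> F" "\<forall>k\<in>K. k \<otimes> a \<in> I" using neg[OF a(1)] by blast
    have "K \<subseteq> annih R (quot_mod (ideal_mod R J) I) X"
    proof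
      fix k assume k: "k \<in> K"
      then have kR: "k \<in> carrier R" using mem_closed(1) K by blast
      have "k \<odot>\<^bsub>quot_mod (ideal_mod R J) I\<^esub> X = I +>\<^bsub>ideal_mod R J\<^esub> (k \<otimes> a)"
        using J.quot_mod_smult[OF sub kR, of a] a by simp
      also have "\<dots> = I" using J.quot_mod_coset_zero_iff[OF sub, of "k \<otimes> a"] K k I by auto
      finally show "k \<in> annih R (quot_mod (ideal_mod R J) I) X" using kR by (simp add: annih_def)
    qed
    then show "annih R (quot_mod (ideal_mod R J) I) X \<in> F"
      using mem_upward[OF K(1) Q.annih_ideal[OF X]] by blast
  qed
  then have "I \<in> ts_prod R F F" using I J by (auto simp: ts_prod_def)
  then show ?thesis using idempotent by simp
qed

text \<open>If \<open>K\<close> kills the coset of \<open>x\<close>, then \<open>a x\<close> is torsion for each \<open>a\<close> in \<open>K\<close>, so \<open>K\<close> is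
  negligible modulo \<open>Ann(x) \<inter> K\<close>; by idempotence \<open>Ann(x) \<inter> K\<close> belongs to \<open>F\<close> and \<open>x\<close> is
  itself torsion.\<close>
lemma tf_quot_torsion_free:
  assumes M: "module R M" and X: "X \<in> carrier (tf_quot R F M)"
    and K: "K \<in> F" "\<And>a. a \<in> K \<Longrightarrow> a \<odot>\<^bsub>tf_quot R F M\<^esub> X = \<zero>\<^bsub>tf_quot R F M\<^esub>"
  shows "X = \<zero>\<^bsub>tf_quot R F M\<^esub>"
proof -
  interpret M: module R M by fact
  note sub = torsion_submodule[OF M]
  obtain x where x: "x \<in> carrier M" "X = torsion R F M +>\<^bsub>M\<^esub> x"
    using X by (auto simp: M.quot_mod_carrier)
  have tors: "a \<odot>\<^bsub>M\<^esub> x \<in> torsion R F M" if "a \<in> K" for a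
    using K(2)[OF that] mem_closed(1)[OF K(1) that] x
    by (simp add: M.quot_mod_smult[OF sub] M.quot_mod_coset_zero_iff[OF sub])
  have "annih R M x \<inter> K \<in> F"
  proof (rule mem_if_negligible[OF K(1)])
    show "ideal (annih R M x \<inter> K) R"
      using i_intersect M.annih_ideal[OF x(1)] mem_ideal[OF K(1)] by blast
    fix a assume a: "a \<in> K"
    obtain L where L: "L \<in> F" "\<And>k. k \<in> L \<Longrightarrow> k \<odot>\<^bsub>M\<^esub> (a \<odot>\<^bsub>M\<^esub> x) = \<zero>\<^bsub>M\<^esub>"
      using torsionE[OF tors[OF a]] by metis
    have "k \<otimes> a \<in> annih R M x \<inter> K" if "k \<in> L" for k
      using L(2)[OF that] mem_closed[OF L(1)] mem_closed[OF K(1)] that a x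
      by (auto simp: annih_def M.smult_assoc1)
    then show "\<exists>L\<in>F. \<forall>k\<in>L. k \<otimes> a \<in> annih R M x \<inter> K" using L(1) by blast
  qed simp
  then have "x \<in> torsion R F M"
    using torsionI[OF M x(1)] by (auto simp: annih_def)
  then show ?thesis using x M.quot_mod_coset_zero_iff[OF sub] by simp
qed

abbreviation "T \<equiv> torsion R F (reg_mod R)"
abbreviation "Q \<equiv> tf_quot R F (reg_mod R)"

lemma T_submodule: "submodule T R (reg_mod R)"
  by (rule torsion_submodule[OF reg_mod_module])

lemma Q_module: "module R Q"
  by (rule tf_quot_module[OF reg_mod_module])

lemma Q_carrier: "X \<in> carrier Q \<longleftrightarrow> (\<exists>x\<in>carrier R. X = T +> x)"
  using module.quot_mod_carrier[OF reg_mod_module] by simp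

lemma Q_add: "x \<in> carrier R \<Longrightarrow> y \<in> carrier R \<Longrightarrow> (T +> x) \<oplus>\<^bsub>Q\<^esub> (T +> y) = T +> (x \<oplus> y)"
  using module.quot_mod_add[OF reg_mod_module T_submodule] by simp

lemma Q_smult: "r \<in> carrier R \<Longrightarrow> x \<in> carrier R \<Longrightarrow> r \<odot>\<^bsub>Q\<^esub> (T +> x) = T +> (r \<otimes> x)"
  using module.quot_mod_smult[OF reg_mod_module T_submodule] by simp

lemma Q_zero: "\<zero>\<^bsub>Q\<^esub> = T" "T +> \<zero> = T"
  using module.quot_mod_zero[OF reg_mod_module] module.submoduleE(1)[OF reg_mod_module T_submodule]
  by simp_all

text \<open>The value \<open>g d\<close> is killed by every annihilator of \<open>d\<close>, hence is torsion in a torsion-free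
  module.\<close>
lemma rep_torsion:
  assumes g: "(J, g) \<in> germ_reps R F (reg_mod R)" and d: "d \<in> J" "d \<in> T"
  shows "g d = \<zero>\<^bsub>Q\<^esub>"
proof -
  interpret Q: module R Q by (rule Q_module)
  note g' = germ_repsD[OF g]
  have zJ: "\<zero> \<in> J" using mem_closed(3)[OF g'(1) zero_closed d(1)] mem_closed(1)[OF g'(1) d(1)] by simp
  have g0: "g \<zero> = \<zero>\<^bsub>Q\<^esub>" using g'(4)[OF zero_closed zJ] g'(2)[OF zJ] by simp
  obtain K where K: "K \<in> F" "\<And>a. a \<in> K \<Longrightarrow> a \<otimes> d = \<zero>"
    using torsionE[OF d(2)] by auto
  show ?thesis
  proof (rule tf_quot_torsion_free[OF reg_mod_module g'(2)[OF d(1)] K(1)])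
    fix a assume a: "a \<in> K"
    show "a \<odot>\<^bsub>Q\<^esub> g d = \<zero>\<^bsub>Q\<^esub>"
      using g'(4)[OF mem_closed(1)[OF K(1) a] d(1)] K(2)[OF a] g0 by simp
  qed
qed

text \<open>Two representatives in \<open>J\<close> of the same coset differ by an element of \<open>J \<inter> T\<close>, on which \<open>g\<close>
  vanishes. Hence the definite description in \<^const>\<open>hom_bar\<close> picks a well-defined value.\<close>
lemma hom_bar_coset:
  assumes g: "(J, g) \<in> germ_reps R F (reg_mod R)" and b: "b \<in> J"
  shows "hom_bar R F J g (T +> b) = g b"
  unfolding hom_bar_def
proof (rule the_equality)
  interpret Q: module R Q by (rule Q_module)
  note g' = germ_repsD[OF g] and J = mem_closed[OF germ_repsD(1)[OF g]]
  show "\<exists>b'\<in>J. T +> b = T +> b' \<and> g b = g b'" using b by blast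
  fix y assume "\<exists>b'\<in>J. T +> b = T +> b' \<and> y = g b'"
  then obtain b' where b': "b' \<in> J" "T +> b = T +> b'" "y = g b'" by blast
  define d where "d = b \<oplus> \<ominus> b'"
  have "d \<in> T"
    using module.quot_mod_coset_eq_iff[OF reg_mod_module T_submodule, of b b'] b b' J(1) by (simp add: d_def)
  moreover have d: "d \<in> J" using b b' J by (simp add: d_def)
  ultimately have "g d = \<zero>\<^bsub>Q\<^esub>" using rep_torsion[OF g] by blast
  moreover have "d \<oplus> b' = b" using J(1) b b' by (simp add: d_def a_assoc l_neg)
  ultimately show "y = g b" using g'(3)[OF d b'(1)] g'(2)[OF b'(1)] b'(3) by simp
qed

lemma mem_ideal_bar:
  assumes "J \<in> F"
  shows "X \<in> ideal_bar R F J \<longleftrightarrow> (\<exists>b\<in>J. X = T +> b)"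
proof -
  interpret T: submodule T R "reg_mod R" by (rule T_submodule)
  interpret Q: module R Q by (rule Q_module)
  have TR: "T \<subseteq> carrier R" and T0: "\<zero> \<in> T" using T.subset T.one_closed by auto
  have eq: "T +> (b \<oplus> t) = T +> b" if "b \<in> J" "t \<in> T" for b t
  proof -
    have "b \<in> carrier R" "t \<in> carrier R" using that mem_closed(1)[OF assms] TR by auto
    moreover have "T +> t = \<zero>\<^bsub>Q\<^esub>"
      using module.quot_mod_coset_zero_iff[OF reg_mod_module T_submodule, of t] that \<open>t \<in> carrier R\<close>
      by (simp add: Q_zero)
    moreover have "T +> b \<in> carrier Q" using \<open>b \<in> carrier R\<close> Q_carrier by blast
    ultimately show ?thesis using Q_add[of b t] by simp
  qed
  have "ideal_bar R F J = {T +> (b \<oplus> t) | b t. b \<in> J \<and> t \<in> T}"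
    by (auto simp: ideal_bar_def Let_def set_add_def')
  also have "\<dots> = {T +> b | b. b \<in> J}" using eq T0 by (auto; metis)
  finally show ?thesis by auto
qed

text \<open>If \<open>f a = T + c\<close>, every \<open>k\<close> in \<open>J\<close> satisfies \<open>f (k a) = T + c k\<close> with \<open>c k\<close> in \<open>J\<close>. So \<open>J\<close>
  multiplies \<open>I\<close> into the domain of the composite, and idempotence applies.\<close>
lemma prod_dom_mem:
  assumes f: "(I, f) \<in> germ_reps R F (reg_mod R)" and J: "J \<in> F"
  shows "{a \<in> I. f a \<in> ideal_bar R F J} \<in> F"
proof (rule mem_if_negligible[OF germ_repsD(1)[OF f]])
  interpret Q: module R Q by (rule Q_module)
  note f' = germ_repsD[OF f] and IF = mem_closed[OF germ_repsD(1)[OF f]] and JF = mem_closed[OF J]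
  have Z: "\<zero> \<in> K" if "K \<in> F" for K
    using additive_subgroup.zero_closed[OF ideal.axioms(1)[OF mem_ideal[OF that]]] .
  show "ideal {a \<in> I. f a \<in> ideal_bar R F J} R"
  proof (rule submodule_idealI)
    have "f \<zero> = \<zero>\<^bsub>Q\<^esub>" using f'(4)[OF zero_closed Z[OF f'(1)]] f'(2)[OF Z[OF f'(1)]] by simp
    then have "f \<zero> = T +> \<zero>" by (simp add: Q_zero)
    then show "\<zero> \<in> {a \<in> I. f a \<in> ideal_bar R F J}"
      using Z f'(1) J unfolding mem_Collect_eq mem_ideal_bar[OF J] by blast
    fix a assume "a \<in> {a \<in> I. f a \<in> ideal_bar R F J}"
    then obtain b where a: "a \<in> I" "b \<in> J" "f a = T +> b" by (auto simp: mem_ideal_bar[OF J])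
    show "r \<otimes> a \<in> {a \<in> I. f a \<in> ideal_bar R F J}" if "r \<in> carrier R" for r
      using f'(4)[OF that a(1)] Q_smult[OF that JF(1)[OF a(2)]] a IF JF that
      by (auto simp: mem_ideal_bar[OF J])
    fix a' assume "a' \<in> {a \<in> I. f a \<in> ideal_bar R F J}"
    then obtain b' where a': "a' \<in> I" "b' \<in> J" "f a' = T +> b'" by (auto simp: mem_ideal_bar[OF J])
    show "a \<oplus> a' \<in> {a \<in> I. f a \<in> ideal_bar R F J}"
      using f'(3)[OF a(1) a'(1)] Q_add[OF JF(1)[OF a(2)] JF(1)[OF a'(2)]] a a' IF JF
      by (auto simp: mem_ideal_bar[OF J])
  qed (use IF in auto)
  fix a assume a: "a \<in> I"
  obtain c where c: "c \<in> carrier R" "f a = T +> c" using f'(2)[OF a] by (auto simp: Q_carrier)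
  have "k \<otimes> a \<in> {a \<in> I. f a \<in> ideal_bar R F J}" if k: "k \<in> J" for k
  proof -
    have "f (k \<otimes> a) = T +> (c \<otimes> k)"
      using f'(4)[OF JF(1)[OF k] a] Q_smult[OF JF(1)[OF k] c(1)] c m_comm[OF c(1) JF(1)[OF k]] by simp
    moreover have "c \<otimes> k \<in> J" "k \<otimes> a \<in> I" using JF k c a IF by auto
    ultimately show ?thesis by (auto simp: mem_ideal_bar[OF J])
  qed
  then show "\<exists>K\<in>F. \<forall>k\<in>K. k \<otimes> a \<in> {a \<in> I. f a \<in> ideal_bar R F J}" using J by blast
qed auto

lemma prod_domE:
  assumes "(I, f) \<in> germ_reps R F (reg_mod R)" "(J, g) \<in> germ_reps R F (reg_mod R)"
    and "a \<in> {a \<in> I. f a \<in> ideal_bar R F J}"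
  obtains b where "a \<in> I" "b \<in> J" "f a = T +> b" "hom_bar R F J g (f a) = g b"
  using assms hom_bar_coset[OF assms(2)] by (auto simp: mem_ideal_bar[OF germ_repsD(1)[OF assms(2)]])

lemma prod_rep:
  assumes f: "(I, f) \<in> germ_reps R F (reg_mod R)" and g: "(J, g) \<in> germ_reps R F (reg_mod R)"
  shows "({a \<in> I. f a \<in> ideal_bar R F J},
    restrict (hom_bar R F J g \<circ> f) {a \<in> I. f a \<in> ideal_bar R F J}) \<in> germ_reps R F (reg_mod R)"
    (is "(?D, _) \<in> _")
proof (rule germ_reps_restrictI)
  note f' = germ_repsD[OF f] and g' = germ_repsD[OF g] and JF = mem_closed[OF germ_repsD(1)[OF g]]
  show "?D \<in> F" by (rule prod_dom_mem[OF f g'(1)])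
  fix a assume "a \<in> ?D"
  then obtain b where a: "a \<in> I" "b \<in> J" "f a = T +> b" "hom_bar R F J g (f a) = g b"
    using prod_domE[OF f g] by blast
  show "(hom_bar R F J g \<circ> f) a \<in> carrier Q" using a g'(2) by simp
  show "(hom_bar R F J g \<circ> f) (r \<otimes> a) = r \<odot>\<^bsub>Q\<^esub> (hom_bar R F J g \<circ> f) a" if r: "r \<in> carrier R" for r
    using a f'(4)[OF r a(1)] g'(4)[OF r a(2)] Q_smult[OF r JF(1)[OF a(2)]]
      hom_bar_coset[OF g JF(3)[OF r a(2)]] by simp
  fix a' assume "a' \<in> ?D"
  then obtain b' where a': "a' \<in> I" "b' \<in> J" "f a' = T +> b'" "hom_bar R F J g (f a') = g b'"
    using prod_domE[OF f g] by blast
  show "(hom_bar R F J g \<circ> f) (a \<oplus> a') = (hom_bar R F J g \<circ> f) a \<oplus>\<^bsub>Q\<^esub> (hom_bar R F J g \<circ> f) a'"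
    using a a' f'(3)[OF a(1) a'(1)] g'(3)[OF a(2) a'(2)] Q_add[OF JF(1)[OF a(2)] JF(1)[OF a'(2)]]
      hom_bar_coset[OF g JF(2)[OF a(2) a'(2)]] by simp
qed

text \<open>If the representatives are changed by maps agreeing with them on \<open>K\<close> and \<open>L\<close>, the two composites
  agree on the elements of \<open>K\<close> that \<open>f\<close> sends into the image of \<open>L\<close>, and these form a member
  of \<open>F\<close>.\<close>
lemma gabriel_mult:
  assumes f: "(I, f) \<in> germ_reps R F (reg_mod R)" and g: "(J, g) \<in> germ_reps R F (reg_mod R)"
  shows "germ R F (reg_mod R) I f \<otimes>\<^bsub>gabriel_ring R F\<^esub> germ R F (reg_mod R) J g =
    germ R F (reg_mod R) {a \<in> I. f a \<in> ideal_bar R F J} (hom_bar R F J g \<circ> f)"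
proof -
  have "(\<Union>(I, f)\<in>germ R F (reg_mod R) I f. \<Union>(J, g)\<in>germ R F (reg_mod R) J g.
      germ R F (reg_mod R) {a \<in> I. f a \<in> ideal_bar R F J} (hom_bar R F J g \<circ> f)) =
      germ R F (reg_mod R) {a \<in> I. f a \<in> ideal_bar R F J} (hom_bar R F J g \<circ> f)"
  proof (rule germ_UN2[OF f g])
    fix I' f' J' g' K L
    assume f': "(I', f') \<in> germ_reps R F (reg_mod R)" and g': "(J', g') \<in> germ_reps R F (reg_mod R)"
      and K: "K \<in> F" "K \<subseteq> I" "K \<subseteq> I'" "\<And>a. a \<in> K \<Longrightarrow> f a = f' a"
      and L: "L \<in> F" "L \<subseteq> J" "L \<subseteq> J'" "\<And>a. a \<in> L \<Longrightarrow> g a = g' a"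
    have D: "{a \<in> K. f a \<in> ideal_bar R F L} \<in> F"
      using prod_dom_mem[OF germ_reps_restrict[OF f K(1,2)] L(1)]
      by (rule back_subst[of "\<lambda>X. X \<in> F"]) auto
    have *: "a \<in> {a \<in> I. f a \<in> ideal_bar R F J} \<and> a \<in> {a \<in> I'. f' a \<in> ideal_bar R F J'} \<and>
        (hom_bar R F J' g' \<circ> f') a = (hom_bar R F J g \<circ> f) a"
      if a: "a \<in> {a \<in> K. f a \<in> ideal_bar R F L}" for a
    proof -
      obtain b where b: "a \<in> K" "b \<in> L" "f a = T +> b"
        using a by (auto simp: mem_ideal_bar[OF L(1)])
      then have "b \<in> J" "b \<in> J'" "a \<in> I" "a \<in> I'" using K L by auto
      moreover have "f' a = T +> b" using K(4) b by simp
      moreover have "hom_bar R F J g (T +> b) = hom_bar R F J' g' (T +> b)"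
        using hom_bar_coset[OF g] hom_bar_coset[OF g'] L(4) b(2) \<open>b \<in> J\<close> \<open>b \<in> J'\<close> by simp
      ultimately show ?thesis
        using b(3) mem_ideal_bar[OF germ_repsD(1)[OF g]] mem_ideal_bar[OF germ_repsD(1)[OF g']]
        by auto
    qed
    show "germ R F (reg_mod R) {a \<in> I'. f' a \<in> ideal_bar R F J'} (hom_bar R F J' g' \<circ> f') =
        germ R F (reg_mod R) {a \<in> I. f a \<in> ideal_bar R F J} (hom_bar R F J g \<circ> f)"
      by (rule germ_eqI[OF prod_rep[OF f' g'] prod_rep[OF f g] D]) (use * in blast)+
  qed
  then show ?thesis by (simp add: gabriel_ring_def)
qed

end


section \<open>Homomorphisms under which every member of the system generates the unit ideal\<close>

locale unit_extension = topologized_ring R F + S: cring S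
  for R (structure) and F and S (structure) and \<phi> +
  assumes hom: "\<phi> \<in> ring_hom R S"
    and unit_ideal: "I \<in> F \<Longrightarrow> Idl\<^bsub>S\<^esub> (\<phi> ` I) = carrier S"
begin

lemmas \<phi>_simps = ring_hom_closed[OF hom] ring_hom_add[OF hom] ring_hom_mult[OF hom] ring_hom_one[OF hom]

text \<open>Every ideal property of elements of \<open>S\<close> that holds on the image of a member of \<open>F\<close> holds at \<open>1\<close>;
  this replaces computations with finite sums \<open>1 = \<Sum> s\<^sub>k \<phi>(a\<^sub>k)\<close>.\<close>
lemma one_mem_ideal:
  assumes "I \<in> F" "ideal L S" "\<phi> ` I \<subseteq> L"
  shows "\<one>\<^bsub>S\<^esub> \<in> L"
  using S.genideal_minimal[OF assms(2,3)] unit_ideal[OF assms(1)] S.one_closed by blast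

lemma zero_if_annihilated:
  assumes M: "module S M" and I: "I \<in> F" and m: "m \<in> carrier M"
    and zero: "\<And>a. a \<in> I \<Longrightarrow> \<phi> a \<odot>\<^bsub>M\<^esub> m = \<zero>\<^bsub>M\<^esub>"
  shows "m = \<zero>\<^bsub>M\<^esub>"
proof -
  interpret M: module S M by fact
  have "\<one>\<^bsub>S\<^esub> \<in> annih S M m"
    by (rule one_mem_ideal[OF I M.annih_ideal[OF m]])
      (use zero \<phi>_simps(1) mem_closed(1)[OF I] in \<open>auto simp: annih_def\<close>)
  then show ?thesis using m by (simp add: annih_def)
qed

lemma eq_if_multiples_eq:
  assumes M: "module S M" and I: "I \<in> F" and m: "m \<in> carrier M" "m' \<in> carrier M"
    and eq: "\<And>a. a \<in> I \<Longrightarrow> \<phi> a \<odot>\<^bsub>M\<^esub> m = \<phi> a \<odot>\<^bsub>M\<^esub> m'"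
  shows "m = m'"
proof -
  interpret M: module S M by fact
  have "m \<oplus>\<^bsub>M\<^esub> \<ominus>\<^bsub>M\<^esub> m' = \<zero>\<^bsub>M\<^esub>"
    by (rule zero_if_annihilated[OF M I])
      (use m eq \<phi>_simps(1) mem_closed(1)[OF I] in \<open>auto simp: M.smult_r_distr M.smult_r_minus M.M.r_neg\<close>)
  then show ?thesis using m by (metis M.M.minus_equality M.M.minus_minus M.M.a_inv_closed)
qed

text \<open>The scalars \<open>s\<close> for which \<open>s \<cdot> g\<close> is of the form \<open>a \<mapsto> \<phi>(a) m\<close> form an ideal of \<open>S\<close>. It contains
  \<open>\<phi>(b)\<close> for \<open>b\<close> in \<open>I\<close>, with \<open>m = g(b)\<close>, because \<open>\<phi>(b) g(a) = g(b a) = \<phi>(a) g(b)\<close>. Hence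
  it contains \<open>1\<close>.\<close>
lemma linear_map_is_multiplication:
  assumes M: "module S M" and I: "I \<in> F"
    and g: "\<And>a. a \<in> I \<Longrightarrow> g a \<in> carrier M"
    and lin: "\<And>r a. r \<in> carrier R \<Longrightarrow> a \<in> I \<Longrightarrow> g (r \<otimes> a) = \<phi> r \<odot>\<^bsub>M\<^esub> g a"
  shows "\<exists>m\<in>carrier M. \<forall>a\<in>I. \<phi> a \<odot>\<^bsub>M\<^esub> m = g a"
proof -
  interpret M: module S M by fact
  have \<phi>I: "\<phi> a \<in> carrier S" if "a \<in> I" for a using \<phi>_simps(1) mem_closed(1)[OF I that] .
  define L where "L = {s \<in> carrier S. \<exists>m\<in>carrier M. \<forall>a\<in>I. \<phi> a \<odot>\<^bsub>M\<^esub> m = s \<odot>\<^bsub>M\<^esub> g a}"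
  have "\<one>\<^bsub>S\<^esub> \<in> L"
  proof (rule one_mem_ideal[OF I])
    show "ideal L S"
    proof (rule S.submodule_idealI)
      show "\<zero>\<^bsub>S\<^esub> \<in> L" using g \<phi>I by (auto simp: L_def intro!: bexI[of _ "\<zero>\<^bsub>M\<^esub>"])
      fix s assume "s \<in> L"
      then obtain m where s: "s \<in> carrier S" "m \<in> carrier M" "\<And>a. a \<in> I \<Longrightarrow> \<phi> a \<odot>\<^bsub>M\<^esub> m = s \<odot>\<^bsub>M\<^esub> g a"
        by (auto simp: L_def)
      have "\<phi> a \<odot>\<^bsub>M\<^esub> (t \<odot>\<^bsub>M\<^esub> m) = (t \<otimes>\<^bsub>S\<^esub> s) \<odot>\<^bsub>M\<^esub> g a" if "t \<in> carrier S" "a \<in> I" for t a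
        using that s g \<phi>I by (metis M.smult_assoc1 S.m_comm)
      then show "t \<otimes>\<^bsub>S\<^esub> s \<in> L" if "t \<in> carrier S" for t
        using that s unfolding L_def by blast
      fix s' assume "s' \<in> L"
      then obtain m' where s': "s' \<in> carrier S" "m' \<in> carrier M"
        "\<And>a. a \<in> I \<Longrightarrow> \<phi> a \<odot>\<^bsub>M\<^esub> m' = s' \<odot>\<^bsub>M\<^esub> g a"
        by (auto simp: L_def)
      have "\<forall>a\<in>I. \<phi> a \<odot>\<^bsub>M\<^esub> (m \<oplus>\<^bsub>M\<^esub> m') = (s \<oplus>\<^bsub>S\<^esub> s') \<odot>\<^bsub>M\<^esub> g a"
        using s s' g \<phi>I by (simp add: M.smult_r_distr M.smult_l_distr)
      then show "s \<oplus>\<^bsub>S\<^esub> s' \<in> L" using s s' unfolding L_def by blast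
    qed (auto simp: L_def)
    show "\<phi> ` I \<subseteq> L"
    proof
      fix s assume "s \<in> \<phi> ` I"
      then obtain b where b: "b \<in> I" "s = \<phi> b" by blast
      have "\<phi> a \<odot>\<^bsub>M\<^esub> g b = s \<odot>\<^bsub>M\<^esub> g a" if "a \<in> I" for a
        using lin[of a b] lin[of b a] that b mem_closed(1)[OF I] m_comm[of a b] by simp
      then show "s \<in> L" using b g \<phi>I unfolding L_def by blast
    qed
  qed
  then show ?thesis using g by (auto simp: L_def)
qed

lemma res_module: "module S M \<Longrightarrow> module R (res_mod \<phi> M)"
  by (rule res_mod_module[OF is_cring _ hom])

lemma torsion_res:
  assumes "module S M"
  shows "torsion R F (res_mod \<phi> M) = {\<zero>\<^bsub>M\<^esub>}"
proof
  interpret M: module S M by fact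
  show "torsion R F (res_mod \<phi> M) \<subseteq> {\<zero>\<^bsub>M\<^esub>}"
  proof
    fix m assume "m \<in> torsion R F (res_mod \<phi> M)"
    then obtain I where "I \<in> F" "\<And>a. a \<in> I \<Longrightarrow> \<phi> a \<odot>\<^bsub>M\<^esub> m = \<zero>\<^bsub>M\<^esub>" "m \<in> carrier M"
      by (elim torsionE) simp
    then show "m \<in> {\<zero>\<^bsub>M\<^esub>}" using zero_if_annihilated[OF assms] by blast
  qed
  show "{\<zero>\<^bsub>M\<^esub>} \<subseteq> torsion R F (res_mod \<phi> M)"
    using torsionI[OF res_module[OF assms] _ carrier_mem] \<phi>_simps(1) by auto
qed

text \<open>As the torsion is zero, the quotient by it is a copy of \<open>M\<close> with singletons in the place of
  elements.\<close>
lemma tf_quot_res: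
  assumes "module S M"
  shows "m \<in> carrier M \<Longrightarrow> torsion R F (res_mod \<phi> M) +>\<^bsub>M\<^esub> m = {m}"
    "X \<in> carrier (tf_quot R F (res_mod \<phi> M)) \<longleftrightarrow> (\<exists>m\<in>carrier M. X = {m})"
    "m \<in> carrier M \<Longrightarrow> n \<in> carrier M \<Longrightarrow> {m} \<oplus>\<^bsub>tf_quot R F (res_mod \<phi> M)\<^esub> {n} = {m \<oplus>\<^bsub>M\<^esub> n}"
    "r \<in> carrier R \<Longrightarrow> m \<in> carrier M \<Longrightarrow> r \<odot>\<^bsub>tf_quot R F (res_mod \<phi> M)\<^esub> {m} = {\<phi> r \<odot>\<^bsub>M\<^esub> m}"
proof -
  interpret M: module S M by fact
  interpret res: module R "res_mod \<phi> M" by (rule res_module[OF assms])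
  have coset: "{\<zero>\<^bsub>M\<^esub>} +>\<^bsub>M\<^esub> m = {m}" if "m \<in> carrier M" for m
    using that by (simp add: a_r_coset_def')
  note sub = torsion_submodule[OF res_module[OF assms]]
  show "m \<in> carrier M \<Longrightarrow> torsion R F (res_mod \<phi> M) +>\<^bsub>M\<^esub> m = {m}"
    by (simp add: torsion_res[OF assms] coset)
  show "X \<in> carrier (tf_quot R F (res_mod \<phi> M)) \<longleftrightarrow> (\<exists>m\<in>carrier M. X = {m})"
    by (auto simp: res.quot_mod_carrier torsion_res[OF assms] coset)
  show "m \<in> carrier M \<Longrightarrow> n \<in> carrier M \<Longrightarrow> {m} \<oplus>\<^bsub>tf_quot R F (res_mod \<phi> M)\<^esub> {n} = {m \<oplus>\<^bsub>M\<^esub> n}"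
    using res.quot_mod_add[OF sub, of m n] by (simp add: torsion_res[OF assms] coset)
  show "r \<in> carrier R \<Longrightarrow> m \<in> carrier M \<Longrightarrow> r \<odot>\<^bsub>tf_quot R F (res_mod \<phi> M)\<^esub> {m} = {\<phi> r \<odot>\<^bsub>M\<^esub> m}"
    using res.quot_mod_smult[OF sub, of r m] \<phi>_simps(1) by (simp add: torsion_res[OF assms] coset)
qed

text \<open>Two elements with the same germ have equal multiples by some member of \<open>F\<close>; and a germ of a linear
  map is the germ of a multiplication.\<close>
theorem gabriel_can_bij:
  assumes M: "module S M"
  shows "bij_betw (gabriel_can R F (res_mod \<phi> M)) (carrier M) (carrier (gabriel_mod R F (res_mod \<phi> M)))"
proof -
  interpret M: module S M by fact
  note Mres = res_module[OF M] and quot = tf_quot_res[OF M]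
  let ?N = "res_mod \<phi> M"
  have rep: "(carrier R, \<lambda>r\<in>carrier R. torsion R F ?N +>\<^bsub>M\<^esub> (\<phi> r \<odot>\<^bsub>M\<^esub> m)) \<in> germ_reps R F ?N"
    if "m \<in> carrier M" for m
    using gabriel_can_rep[OF Mres, of m] that by simp
  have can: "gabriel_can R F ?N m =
      germ R F ?N (carrier R) (\<lambda>r\<in>carrier R. torsion R F ?N +>\<^bsub>M\<^esub> (\<phi> r \<odot>\<^bsub>M\<^esub> m))" for m
    by (simp add: gabriel_can_def germ_restrict)
  show ?thesis
  proof (rule bij_betw_imageI)
    show "inj_on (gabriel_can R F ?N) (carrier M)"
    proof (rule inj_onI)
      fix m m' assume m: "m \<in> carrier M" "m' \<in> carrier M" and eq: "gabriel_can R F ?N m = gabriel_can R F ?N m'"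
      obtain K where K: "K \<in> F" "K \<subseteq> carrier R"
        "\<forall>a\<in>K. (\<lambda>r\<in>carrier R. torsion R F ?N +>\<^bsub>M\<^esub> (\<phi> r \<odot>\<^bsub>M\<^esub> m)) a =
           (\<lambda>r\<in>carrier R. torsion R F ?N +>\<^bsub>M\<^esub> (\<phi> r \<odot>\<^bsub>M\<^esub> m')) a"
        using germ_eqD[OF rep[OF m(1)] rep[OF m(2)] eq[unfolded can]] by blast
      have "\<phi> a \<odot>\<^bsub>M\<^esub> m = \<phi> a \<odot>\<^bsub>M\<^esub> m'" if "a \<in> K" for a
        using K(3) that K(2) m \<phi>_simps(1) by (auto simp: quot(1) subset_iff)
      then show "m = m'" by (rule eq_if_multiples_eq[OF M K(1) m])
    qed
    show "gabriel_can R F ?N ` carrier M = carrier (gabriel_mod R F ?N)"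
    proof
      show "gabriel_can R F ?N ` carrier M \<subseteq> carrier (gabriel_mod R F ?N)"
        using gabriel_can_in_carrier[OF Mres] by auto
      show "carrier (gabriel_mod R F ?N) \<subseteq> gabriel_can R F ?N ` carrier M"
      proof
        fix X assume "X \<in> carrier (gabriel_mod R F ?N)"
        then obtain I f where f: "(I, f) \<in> germ_reps R F ?N" "X = germ R F ?N I f"
          by (auto simp: gabriel_mod_carrier)
        note f' = germ_repsD[OF f(1)]
        define g where "g a = the_elem (f a)" for a
        have g: "g a \<in> carrier M" "f a = {g a}" if a: "a \<in> I" for a
        proof -
          obtain m where "m \<in> carrier M" "f a = {m}" using f'(2)[OF a] quot(2) by blast
          then show "g a \<in> carrier M" "f a = {g a}" by (simp_all add: g_def)
        qed
        have lin: "g (r \<otimes> a) = \<phi> r \<odot>\<^bsub>M\<^esub> g a" if "r \<in> carrier R" "a \<in> I" for r a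
          using f'(4)[OF that] g[OF that(2)] quot(4)[OF that(1) g(1)[OF that(2)]]
          by (simp add: g_def[of "r \<otimes> a"])
        have "\<exists>m\<in>carrier M. \<forall>a\<in>I. \<phi> a \<odot>\<^bsub>M\<^esub> m = g a"
          by (rule linear_map_is_multiplication[OF M f'(1) g(1) lin])
        then obtain m where m: "m \<in> carrier M" "\<forall>a\<in>I. \<phi> a \<odot>\<^bsub>M\<^esub> m = g a" by blast
        have "germ R F ?N (carrier R) (\<lambda>r. torsion R F ?N +>\<^bsub>M\<^esub> (\<phi> r \<odot>\<^bsub>M\<^esub> m)) = germ R F ?N I f"
        proof (rule germ_eqI[OF rep[OF m(1)] _ f'(1)])
          show "(I, restrict f I) \<in> germ_reps R F ?N" using f f'(5) by simp
          show "I \<subseteq> carrier R" by (rule mem_subset[OF f'(1)])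
          show "torsion R F ?N +>\<^bsub>M\<^esub> (\<phi> a \<odot>\<^bsub>M\<^esub> m) = f a" if "a \<in> I" for a
            using m(2) g that by (simp add: quot(1))
        qed simp
        then show "X \<in> gabriel_can R F ?N ` carrier M"
          using f(2) m(1) by (auto simp: gabriel_can_def)
      qed
    qed
  qed
qed

end



section \<open>The factorization through the localized ring\<close>

locale idempotent_unit_extension = unit_extension + idempotent_system
begin

abbreviation S_res where "S_res \<equiv> res_mod \<phi> (reg_mod S)"

definition factor_map where
  "factor_map = inv_into (carrier S) (gabriel_can R F S_res) \<circ> gabriel_map R F S_res \<phi>"

lemmas S_module = S.reg_mod_module
lemmas S_tf_quot = tf_quot_res[OF S_module, simplified]

lemma T_kernel:
  assumes "t \<in> T"
  shows "\<phi> t = \<zero>\<^bsub>S\<^esub>"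
proof -
  obtain I where I: "I \<in> F" "\<And>a. a \<in> I \<Longrightarrow> a \<otimes> t = \<zero>" "t \<in> carrier R"
    using torsionE[OF assms] by (metis reg_mod_simps)
  have "\<phi> \<zero> = \<zero>\<^bsub>S\<^esub>" by (rule ring_hom_zero[OF hom ring_axioms S.ring_axioms])
  then have "\<phi> a \<otimes>\<^bsub>S\<^esub> \<phi> t = \<zero>\<^bsub>S\<^esub>" if "a \<in> I" for a
    using I that \<phi>_simps(3)[of a t] mem_closed(1)[OF I(1)] by simp
  then show ?thesis using zero_if_annihilated[OF S_module I(1), of "\<phi> t"] \<phi>_simps(1) I(3) by simp
qed

text \<open>Hence \<open>\<phi>\<close> induces a map on \<open>R/T\<close>.\<close>
lemma T_coset_image:
  assumes "x \<in> carrier R" "c \<in> T +> x"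
  shows "\<phi> c = \<phi> x"
proof -
  obtain t where t: "t \<in> T" "c = t \<oplus> x" using assms(2) by (auto simp: a_r_coset_def')
  then have "t \<in> carrier R" by (auto simp: torsion_def)
  then show ?thesis using t assms(1) T_kernel[OF t(1)] by (simp add: \<phi>_simps)
qed

lemma T_coset_self: "x \<in> carrier R \<Longrightarrow> x \<in> T +> x"
  using module.quot_mod_self_mem[OF reg_mod_module T_submodule, of x] by simp

lemma tf_map_coset:
  assumes "x \<in> carrier R"
  shows "tf_map R F S_res \<phi> (T +> x) = {\<phi> x}"
proof -
  have "torsion R F S_res +>\<^bsub>S_res\<^esub> \<phi> c = {\<phi> x}" if "c \<in> T +> x" for c
    using T_coset_image[OF assms that] \<phi>_simps(1)[OF assms] S_tf_quot(1) by simp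
  then show ?thesis using T_coset_self[OF assms] unfolding tf_map_def by blast
qed

lemma gabriel_map_rep:
  assumes f: "(I, f) \<in> germ_reps R F (reg_mod R)"
  shows "(I, restrict (tf_map R F S_res \<phi> \<circ> f) I) \<in> germ_reps R F S_res"
proof (rule germ_reps_restrictI)
  note f' = germ_repsD[OF f]
  show "I \<in> F" by (rule f'(1))
  fix x assume x: "x \<in> I"
  obtain c where c: "c \<in> carrier R" "f x = T +> c" using f'(2)[OF x] unfolding Q_carrier by blast
  show "(tf_map R F S_res \<phi> \<circ> f) x \<in> carrier (tf_quot R F S_res)"
    using c \<phi>_simps(1) by (simp add: tf_map_coset S_tf_quot(2))
  show "(tf_map R F S_res \<phi> \<circ> f) (r \<otimes> x) = r \<odot>\<^bsub>tf_quot R F S_res\<^esub> (tf_map R F S_res \<phi> \<circ> f) x"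
    if r: "r \<in> carrier R" for r
    using f'(4)[OF r x] c r by (simp add: Q_smult tf_map_coset S_tf_quot(4) \<phi>_simps)
  fix y assume y: "y \<in> I"
  obtain d where d: "d \<in> carrier R" "f y = T +> d" using f'(2)[OF y] unfolding Q_carrier by blast
  show "(tf_map R F S_res \<phi> \<circ> f) (x \<oplus> y) =
      (tf_map R F S_res \<phi> \<circ> f) x \<oplus>\<^bsub>tf_quot R F S_res\<^esub> (tf_map R F S_res \<phi> \<circ> f) y"
    using f'(3)[OF x y] c d by (simp add: Q_add tf_map_coset S_tf_quot(3) \<phi>_simps)
qed

lemma gabriel_map_germ:
  assumes f: "(I, f) \<in> germ_reps R F (reg_mod R)"
  shows "gabriel_map R F S_res \<phi> (germ R F (reg_mod R) I f) = germ R F S_res I (tf_map R F S_res \<phi> \<circ> f)"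
  unfolding gabriel_map_def
proof (rule germ_UN[OF f])
  fix I' f' K
  assume f': "(I', f') \<in> germ_reps R F (reg_mod R)" and K: "K \<in> F" "K \<subseteq> I" "K \<subseteq> I'"
    and eq: "\<And>a. a \<in> K \<Longrightarrow> f a = f' a"
  show "germ R F S_res I' (tf_map R F S_res \<phi> \<circ> f') = germ R F S_res I (tf_map R F S_res \<phi> \<circ> f)"
    by (rule germ_eqI[OF gabriel_map_rep[OF f'] gabriel_map_rep[OF f] K(1,3,2)]) (simp add: eq)
qed

text \<open>The equations say that \<open>a \<mapsto> \<phi>(a) s\<close> and the map induced by \<open>f\<close> agree on \<open>I\<close>, so the image of
  the germ in \<open>S\<^sub>F\<close> is the germ of \<open>s\<close>. All properties of the factorization are derived from this
  criterion and its converse.\<close>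
lemma factor_map_germ_eqI:
  assumes f: "(I, f) \<in> germ_reps R F (reg_mod R)" and s: "s \<in> carrier S"
    and eq: "\<And>a c. a \<in> I \<Longrightarrow> c \<in> carrier R \<Longrightarrow> f a = T +> c \<Longrightarrow> \<phi> a \<otimes>\<^bsub>S\<^esub> s = \<phi> c"
  shows "factor_map (germ R F (reg_mod R) I f) = s"
proof -
  note f' = germ_repsD[OF f]
  have "gabriel_can R F S_res s = germ R F S_res I (tf_map R F S_res \<phi> \<circ> f)"
    unfolding gabriel_can_def
  proof (rule germ_eqI[OF gabriel_can_rep[OF res_module[OF S_module]] gabriel_map_rep[OF f] f'(1)])
    show "I \<subseteq> carrier R" by (rule mem_subset[OF f'(1)])
    fix a assume a: "a \<in> I"
    obtain c where c: "c \<in> carrier R" "f a = T +> c" using f'(2)[OF a] unfolding Q_carrier by blast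
    then show "torsion R F S_res +>\<^bsub>S_res\<^esub> (a \<odot>\<^bsub>S_res\<^esub> s) = (tf_map R F S_res \<phi> \<circ> f) a"
      using eq[OF a c] \<phi>_simps(1) by (simp add: tf_map_coset S_tf_quot(1))
  qed (use s in auto)
  then have "factor_map (germ R F (reg_mod R) I f) =
      inv_into (carrier S) (gabriel_can R F S_res) (gabriel_can R F S_res s)"
    by (simp add: factor_map_def gabriel_map_germ[OF f])
  also have "\<dots> = s"
    using gabriel_can_bij[OF S_module] s by (intro inv_into_f_f) (auto dest: bij_betw_imp_inj_on)
  finally show ?thesis .
qed

text \<open>The map that \<open>f\<close> and \<open>\<phi>\<close> induce from \<open>I\<close> to \<open>S\<close> is linear, hence a multiplication by some
  \<open>s\<close>; this \<open>s\<close> is the value.\<close>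
lemma factor_map_germ:
  assumes f: "(I, f) \<in> germ_reps R F (reg_mod R)"
  shows "factor_map (germ R F (reg_mod R) I f) \<in> carrier S"
    and "a \<in> I \<Longrightarrow> c \<in> carrier R \<Longrightarrow> f a = T +> c \<Longrightarrow> \<phi> a \<otimes>\<^bsub>S\<^esub> factor_map (germ R F (reg_mod R) I f) = \<phi> c"
proof -
  note f' = germ_repsD[OF f]
  \<comment> \<open>By \<open>T_coset_image\<close>, \<open>\<phi>\<close> is constant on each coset \<open>f a\<close>; \<open>g\<close> takes that value.\<close>
  define g where "g a = (THE s. s \<in> \<phi> ` (f a))" for a
  have g: "g a = \<phi> c" if c: "c \<in> carrier R" "f a = T +> c" for a c
    unfolding g_def
  proof (rule the_equality)
    show "\<phi> c \<in> \<phi> ` f a" using c T_coset_self by blast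
    show "s = \<phi> c" if "s \<in> \<phi> ` f a" for s using that c T_coset_image by auto
  qed
  have rep: "\<exists>c\<in>carrier R. f a = T +> c" if "a \<in> I" for a
    using f'(2)[OF that] unfolding Q_carrier .
  have "\<exists>s\<in>carrier (reg_mod S). \<forall>a\<in>I. \<phi> a \<odot>\<^bsub>reg_mod S\<^esub> s = g a"
  proof (rule linear_map_is_multiplication[OF S_module f'(1)])
    fix a assume a: "a \<in> I"
    obtain c where c: "c \<in> carrier R" "f a = T +> c" using rep[OF a] by blast
    then show "g a \<in> carrier (reg_mod S)" using g \<phi>_simps(1) by simp
    fix r assume r: "r \<in> carrier R"
    have "f (r \<otimes> a) = T +> (r \<otimes> c)" using f'(4)[OF r a] c r by (simp add: Q_smult)
    then have "g (r \<otimes> a) = \<phi> (r \<otimes> c)" using g c r by simp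
    then show "g (r \<otimes> a) = \<phi> r \<odot>\<^bsub>reg_mod S\<^esub> g a" using g[OF c] c r \<phi>_simps(3) by simp
  qed
  then obtain s where s: "s \<in> carrier S" "\<And>a. a \<in> I \<Longrightarrow> \<phi> a \<otimes>\<^bsub>S\<^esub> s = g a" by auto
  have "factor_map (germ R F (reg_mod R) I f) = s"
    by (rule factor_map_germ_eqI[OF f s(1)]) (simp add: s(2) g)
  then show "factor_map (germ R F (reg_mod R) I f) \<in> carrier S"
    and "a \<in> I \<Longrightarrow> c \<in> carrier R \<Longrightarrow> f a = T +> c \<Longrightarrow> \<phi> a \<otimes>\<^bsub>S\<^esub> factor_map (germ R F (reg_mod R) I f) = \<phi> c"
    using s g by simp_all
qed

lemma factor_map_can:
  assumes "r \<in> carrier R"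
  shows "factor_map (gabriel_can R F (reg_mod R) r) = \<phi> r"
proof -
  have rep: "(carrier R, \<lambda>x\<in>carrier R. T +> (x \<otimes> r)) \<in> germ_reps R F (reg_mod R)"
    using gabriel_can_rep[OF reg_mod_module, of r] assms by simp
  have "factor_map (germ R F (reg_mod R) (carrier R) (\<lambda>x\<in>carrier R. T +> (x \<otimes> r))) = \<phi> r"
  proof (rule factor_map_germ_eqI[OF rep])
    fix a c assume "a \<in> carrier R" "c \<in> carrier R" "(\<lambda>x\<in>carrier R. T +> (x \<otimes> r)) a = T +> c"
    then show "\<phi> a \<otimes>\<^bsub>S\<^esub> \<phi> r = \<phi> c"
      using T_coset_image[of "a \<otimes> r" c] T_coset_self[of c] assms by (simp add: \<phi>_simps)
  qed (use assms \<phi>_simps in auto)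
  then show ?thesis by (simp add: gabriel_can_def germ_restrict)
qed

lemma gabriel_ring_carrier:
  "X \<in> carrier (gabriel_ring R F) \<longleftrightarrow> (\<exists>I f. (I, f) \<in> germ_reps R F (reg_mod R) \<and> X = germ R F (reg_mod R) I f)"
  by (simp add: gabriel_ring_def gabriel_mod_carrier)

text \<open>Let \<open>x\<close> and \<open>y\<close> be the germs of \<open>f\<close> and \<open>g\<close>. If \<open>f a = T + b\<close> with \<open>b\<close> in \<open>J\<close> and
  \<open>g b = T + c\<close>, then \<open>\<phi>(c) = \<phi>(b) \<psi>(y) = \<phi>(a) \<psi>(x) \<psi>(y)\<close>.\<close>
lemma factor_map_mult:
  assumes f: "(I, f) \<in> germ_reps R F (reg_mod R)" and g: "(J, g) \<in> germ_reps R F (reg_mod R)"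
  shows "factor_map (germ R F (reg_mod R) I f \<otimes>\<^bsub>gabriel_ring R F\<^esub> germ R F (reg_mod R) J g) =
    factor_map (germ R F (reg_mod R) I f) \<otimes>\<^bsub>S\<^esub> factor_map (germ R F (reg_mod R) J g)"
proof -
  define D h where "D = {a \<in> I. f a \<in> ideal_bar R F J}" and "h = hom_bar R F J g \<circ> f"
  have rep: "(D, restrict h D) \<in> germ_reps R F (reg_mod R)"
    unfolding D_def h_def by (rule prod_rep[OF f g])
  note in_S = factor_map_germ(1)[OF f] factor_map_germ(1)[OF g]
  have "factor_map (germ R F (reg_mod R) D (restrict h D)) =
      factor_map (germ R F (reg_mod R) I f) \<otimes>\<^bsub>S\<^esub> factor_map (germ R F (reg_mod R) J g)"
  proof (rule factor_map_germ_eqI[OF rep])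
    fix a c assume a: "a \<in> D" and c: "c \<in> carrier R" "restrict h D a = T +> c"
    obtain b where b: "a \<in> I" "b \<in> J" "f a = T +> b" "hom_bar R F J g (f a) = g b"
      using prod_domE[OF f g] a unfolding D_def by blast
    have bR: "b \<in> carrier R" using mem_closed(1)[OF germ_repsD(1)[OF g] b(2)] .
    have "g b = T +> c" using a b c by (simp add: h_def)
    then have "\<phi> c = \<phi> b \<otimes>\<^bsub>S\<^esub> factor_map (germ R F (reg_mod R) J g)" using factor_map_germ(2)[OF g b(2) c(1)] by simp
    also have "\<phi> b = \<phi> a \<otimes>\<^bsub>S\<^esub> factor_map (germ R F (reg_mod R) I f)" using factor_map_germ(2)[OF f b(1) bR b(3)] by simp
    finally show "\<phi> a \<otimes>\<^bsub>S\<^esub> (factor_map (germ R F (reg_mod R) I f) \<otimes>\<^bsub>S\<^esub> factor_map (germ R F (reg_mod R) J g)) = \<phi> c"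
      using in_S \<phi>_simps(1) mem_closed(1)[OF germ_repsD(1)[OF f] b(1)] by (simp add: S.m_assoc)
  qed (use in_S in simp)
  then show ?thesis by (simp add: gabriel_mult[OF f g] germ_restrict D_def h_def)
qed

lemma factor_map_add:
  assumes f: "(I, f) \<in> germ_reps R F (reg_mod R)" and g: "(J, g) \<in> germ_reps R F (reg_mod R)"
  shows "factor_map (germ R F (reg_mod R) I f \<oplus>\<^bsub>gabriel_ring R F\<^esub> germ R F (reg_mod R) J g) =
    factor_map (germ R F (reg_mod R) I f) \<oplus>\<^bsub>S\<^esub> factor_map (germ R F (reg_mod R) J g)"
proof -
  note rep = gabriel_add_rep[OF reg_mod_module f g]
  note in_S = factor_map_germ(1)[OF f] factor_map_germ(1)[OF g]
  have "factor_map (germ R F (reg_mod R) (I \<inter> J) (\<lambda>a\<in>I \<inter> J. f a \<oplus>\<^bsub>Q\<^esub> g a)) =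
      factor_map (germ R F (reg_mod R) I f) \<oplus>\<^bsub>S\<^esub> factor_map (germ R F (reg_mod R) J g)"
  proof (rule factor_map_germ_eqI[OF rep])
    fix a c assume a: "a \<in> I \<inter> J" and c: "c \<in> carrier R" "(\<lambda>a\<in>I \<inter> J. f a \<oplus>\<^bsub>Q\<^esub> g a) a = T +> c"
    have aI: "a \<in> I" and aJ: "a \<in> J" using a by auto
    obtain x y where x: "x \<in> carrier R" "f a = T +> x" and y: "y \<in> carrier R" "g a = T +> y"
      using germ_repsD(2)[OF f aI] germ_repsD(2)[OF g aJ] unfolding Q_carrier by blast
    have "T +> (x \<oplus> y) = T +> c" using a c x y by (simp add: Q_add)
    then have "\<phi> c = \<phi> (x \<oplus> y)"
      using T_coset_image[of "x \<oplus> y" c] T_coset_self[OF c(1)] x y by simp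
    then show "\<phi> a \<otimes>\<^bsub>S\<^esub> (factor_map (germ R F (reg_mod R) I f) \<oplus>\<^bsub>S\<^esub> factor_map (germ R F (reg_mod R) J g)) = \<phi> c"
      using factor_map_germ(2)[OF f aI x] factor_map_germ(2)[OF g aJ y] in_S x y \<phi>_simps
        mem_closed(1)[OF germ_repsD(1)[OF f] aI] by (simp add: S.r_distr)
  qed (use in_S in simp)
  then show ?thesis
    using gabriel_add[OF reg_mod_module f g] by (simp add: germ_restrict gabriel_ring_def)
qed

lemma factor_map_ring_hom: "factor_map \<in> ring_hom (gabriel_ring R F) S"
proof (rule ring_hom_memI)
  fix X assume "X \<in> carrier (gabriel_ring R F)"
  then obtain I f where f: "(I, f) \<in> germ_reps R F (reg_mod R)" "X = germ R F (reg_mod R) I f"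
    unfolding gabriel_ring_carrier by blast
  show "factor_map X \<in> carrier S" using factor_map_germ(1)[OF f(1)] f(2) by simp
  fix Y assume "Y \<in> carrier (gabriel_ring R F)"
  then obtain J g where g: "(J, g) \<in> germ_reps R F (reg_mod R)" "Y = germ R F (reg_mod R) J g"
    unfolding gabriel_ring_carrier by blast
  show "factor_map (X \<otimes>\<^bsub>gabriel_ring R F\<^esub> Y) = factor_map X \<otimes>\<^bsub>S\<^esub> factor_map Y" using factor_map_mult[OF f(1) g(1)] f(2) g(2) by simp
  show "factor_map (X \<oplus>\<^bsub>gabriel_ring R F\<^esub> Y) = factor_map X \<oplus>\<^bsub>S\<^esub> factor_map Y" using factor_map_add[OF f(1) g(1)] f(2) g(2) by simp
next
  have "\<one>\<^bsub>gabriel_ring R F\<^esub> = germ R F (reg_mod R) (carrier R) (\<lambda>r\<in>carrier R. T +> r)"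
    by (simp add: gabriel_ring_def germ_restrict)
  also have "(\<lambda>r\<in>carrier R. T +> r) = (\<lambda>r\<in>carrier R. T +> (r \<otimes> \<one>))" by (rule restrict_ext) simp
  finally have "\<one>\<^bsub>gabriel_ring R F\<^esub> = gabriel_can R F (reg_mod R) \<one>"
    by (simp only: gabriel_can_def germ_restrict reg_mod_simps reg_mod_coset)
  then show "factor_map \<one>\<^bsub>gabriel_ring R F\<^esub> = \<one>\<^bsub>S\<^esub>" using factor_map_can[OF one_closed] \<phi>_simps(4) by simp
qed

text \<open>The product is represented by \<open>r \<mapsto> f (r a) = r f(a) = T + r c\<close>, which is defined on all
  of \<open>R\<close> as \<open>a\<close> lies in \<open>I\<close>. This equation determines the value of a homomorphism on the
  germ of \<open>f\<close> from its values on the image of \<open>R\<close>.\<close>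
lemma can_mult_germ:
  assumes f: "(I, f) \<in> germ_reps R F (reg_mod R)" and a: "a \<in> I"
    and c: "c \<in> carrier R" "f a = T +> c"
  shows "gabriel_can R F (reg_mod R) a \<otimes>\<^bsub>gabriel_ring R F\<^esub> germ R F (reg_mod R) I f =
    gabriel_can R F (reg_mod R) c"
proof -
  note f' = germ_repsD[OF f] and IF = mem_closed[OF germ_repsD(1)[OF f]]
  define k where "k = (\<lambda>r\<in>carrier R. T +> (r \<otimes> a))"
  have can: "gabriel_can R F (reg_mod R) x = germ R F (reg_mod R) (carrier R) (\<lambda>r\<in>carrier R. T +> (r \<otimes> x))" for x
    by (simp add: gabriel_can_def germ_restrict)
  have k: "(carrier R, k) \<in> germ_reps R F (reg_mod R)"
    using gabriel_can_rep[OF reg_mod_module, of a] IF(1)[OF a] by (simp add: k_def)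
  have c_rep: "(carrier R, \<lambda>r\<in>carrier R. T +> (r \<otimes> c)) \<in> germ_reps R F (reg_mod R)"
    using gabriel_can_rep[OF reg_mod_module, of c] c by simp
  have ra: "r \<otimes> a \<in> I" "k r = T +> (r \<otimes> a)" if "r \<in> carrier R" for r
    using IF that a by (auto simp: k_def)
  have "germ R F (reg_mod R) {r \<in> carrier R. k r \<in> ideal_bar R F I} (hom_bar R F I f \<circ> k) =
      germ R F (reg_mod R) (carrier R) (\<lambda>r\<in>carrier R. T +> (r \<otimes> c))"
  proof (rule germ_eqI[OF prod_rep[OF k f] _ carrier_mem])
    show "carrier R \<subseteq> {r \<in> carrier R. k r \<in> ideal_bar R F I}"
      using ra by (auto simp: mem_ideal_bar[OF f'(1)])
    show "(carrier R, \<lambda>x\<in>carrier R. (\<lambda>r\<in>carrier R. T +> (r \<otimes> c)) x) \<in> germ_reps R F (reg_mod R)"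
      by (simp only: restrict_restrict Int_absorb c_rep)
    fix r assume r: "r \<in> carrier R"
    show "(hom_bar R F I f \<circ> k) r = (\<lambda>r\<in>carrier R. T +> (r \<otimes> c)) r"
      using r ra[OF r] hom_bar_coset[OF f ra(1)[OF r]] f'(4)[OF r a] c by (simp add: Q_smult)
  qed simp
  then show ?thesis using gabriel_mult[OF k f] by (simp add: can k_def)
qed

lemma factor_map_unique:
  assumes \<chi>: "\<chi> \<in> ring_hom (gabriel_ring R F) S"
    and fact: "\<And>r. r \<in> carrier R \<Longrightarrow> \<phi> r = \<chi> (gabriel_can R F (reg_mod R) r)"
    and X: "X \<in> carrier (gabriel_ring R F)"
  shows "\<chi> X = factor_map X"
proof -
  obtain I f where f: "(I, f) \<in> germ_reps R F (reg_mod R)" "X = germ R F (reg_mod R) I f"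
    using X unfolding gabriel_ring_carrier by blast
  note f' = germ_repsD[OF f(1)]
  have "factor_map (germ R F (reg_mod R) I f) = \<chi> X"
  proof (rule factor_map_germ_eqI[OF f(1) ring_hom_closed[OF \<chi> X]])
    fix a c assume a: "a \<in> I" and c: "c \<in> carrier R" "f a = T +> c"
    have aR: "a \<in> carrier R" by (rule mem_closed(1)[OF f'(1) a])
    have can: "gabriel_can R F (reg_mod R) a \<in> carrier (gabriel_ring R F)"
      using gabriel_can_in_carrier[OF reg_mod_module] aR by (simp add: gabriel_ring_def)
    show "\<phi> a \<otimes>\<^bsub>S\<^esub> \<chi> X = \<phi> c"
      using ring_hom_mult[OF \<chi> can X] can_mult_germ[OF f(1) a c] fact aR c(1) f(2) by simp
  qed
  then show ?thesis using f(2) by simp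
qed

end

theorem theorem2p16:
  fixes R :: "('r, 'x) ring_scheme" and S :: "('s, 'y) ring_scheme"
    and F :: "'r set set" and \<phi> :: "'r \<Rightarrow> 's"
  assumes "cring R" and "cring S" and "\<phi> \<in> ring_hom R S"
    and "idempotent_ts R F"
    and "\<And>I. I \<in> F \<Longrightarrow> Idl\<^bsub>S\<^esub> (\<phi> ` I) = carrier S"
  defines "j\<^sub>R \<equiv> gabriel_can R F (reg_mod R)"
    and "j\<^sub>S \<equiv> gabriel_can R F (res_mod \<phi> (reg_mod S))"
    and "\<phi>\<^sub>F \<equiv> gabriel_map R F (res_mod \<phi> (reg_mod S)) \<phi>"
  defines "\<psi> \<equiv> inv_into (carrier S) j\<^sub>S \<circ> \<phi>\<^sub>F"
  shows "(\<forall>M :: ('s, 'm, 'z) module_scheme. module S M \<longrightarrow>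
            bij_betw (gabriel_can R F (res_mod \<phi> M)) (carrier M)
              (carrier (gabriel_mod R F (res_mod \<phi> M)))) \<and>
         (\<psi> \<in> ring_hom (gabriel_ring R F) S \<and>
          (\<forall>r\<in>carrier R. \<phi> r = \<psi> (j\<^sub>R r)) \<and>
          (\<forall>\<chi>\<in>ring_hom (gabriel_ring R F) S. (\<forall>r\<in>carrier R. \<phi> r = \<chi> (j\<^sub>R r)) \<longrightarrow>
             (\<forall>x\<in>carrier (gabriel_ring R F). \<chi> x = \<psi> x)))"
proof -
  interpret idempotent_unit_extension R F S \<phi>
    using assms(1-5)
    by (intro idempotent_unit_extension.intro unit_extension.intro topologized_ring.intro
        idempotent_system.intro topologized_ring_axioms.intro unit_extension_axioms.intro
        idempotent_system_axioms.intro)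
      (auto simp: idempotent_ts_def)
  have \<psi>: "\<psi> = factor_map"
    by (simp add: \<psi>_def factor_map_def j\<^sub>S_def \<phi>\<^sub>F_def)
  show ?thesis
    unfolding \<psi> j\<^sub>R_def
    using gabriel_can_bij factor_map_ring_hom factor_map_can factor_map_unique by auto
qed

end
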